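(* Let $$\widetilde{A}_n=\nu I_n+\sum_{i=1}^d\left(\widetilde{v}_{i,+}\widetilde{W}_i+\widetilde{v}_{i,-}\widetilde{W}_i^{\top}\right),\qquad\widetilde{W}_i=I_{n_i^-}\otimes\widetilde{L}_{n_i}^{(\alpha_i)}\otimes I_{n_i^+},$$ $$\widetilde{P}_n=\nu I_n+\sum_{i=1}^d(\widetilde{v}_{i,+}+\widetilde{v}_{i,-})\,I_{n_i^-}\otimes\tau\!\left(\mathcal{H}\!\left(\widetilde{L}_{n_i}^{(\alpha_i)}\right)\right)\otimes I_{n_i^+}.$$ Then the eigenvalues of $\widetilde{P}_n^{-1}Y_n\widetilde{A}_n$ lie in $$\left(-\tfrac32(1+\epsilon),-\tfrac12\right)\cup\left(\tfrac12,\tfrac32(1+\epsilon)\right)$$ for some $\epsilon$ with $$\epsilon<\max_{1\le i\le d}\frac{|d_{i,+}-d_{i,-}|}{d_{i,+}+d_{i,-}}\left|\tan\left(\frac{\alpha_i}{2}\pi\right)\right|.$$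
   Context: Setting (first-order scheme): $d\ge1$; for $i=1,\dots,d$: real numbers $a_i<b_i$, $\alpha_i\in(1,2)$, nonnegative constants $d_{i,+},d_{i,-}$, positive integers $n_i$, $h_i=(b_i-a_i)/(n_i+1)$, $\widetilde{v}_{i,\pm}=d_{i,\pm}/h_i^{\alpha_i}$. Further $\nu=1/\tau$ with time step $\tau=T/M$, $T>0$, $M$ a positive integer. $n=\prod_{i=1}^dn_i$, $n_i^-=\prod_{j=1}^{i-1}n_j$, $n_i^+=\prod_{j=i+1}^dn_j$ (empty products equal $1$). $I_m$ is the $m\times m$ identity, $\otimes$ the Kronecker product. For $\alpha\in(1,2)$: $\widetilde{g}_k^{(\alpha)}=(-1)^k\binom{\alpha}{k}=\frac{(-1)^k}{k!}\alpha(\alpha-1)\cdots(\alpha-k+1)$, $k\ge0$, with $\binom{\alpha}{0}=1$; $\widetilde{L}_m^{(\alpha)}\in\mathbb{R}^{m\times m}$ is the Toeplitz matrix with $(j,k)$ entry $-\widetilde{g}_{j-k+1}^{(\alpha)}$ if $j-k\ge-1$ and $0$ otherwise. $\mathcal{H}(Z)=(Z+Z^{\top})/2$ for a real square matrix $Z$. For a symmetric Toeplitz matrix $T_m$ with first column $(t_1,\dots,t_m)^{\top}$, $\tau(T_m):=T_m-H_m$, where $H_m$ is the Hankel matrix with first column $(t_3,t_4,\dots,t_m,0,0)^{\top}$ and last column $(0,0,t_m,\dots,t_4,t_3)^{\top}$. $Y_m$ is the $m\times m$ anti-identity matrix ($[Y_m]_{j,k}=1$ iff $j+k=m+1$, else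 $0$) and $Y_n=Y_{n_1}\otimes\cdots\otimes Y_{n_d}$. *)

theory Defs
  imports Complex_Main "Jordan_Normal_Form.Matrix" "Jordan_Normal_Form.Char_Poly"
begin

definition kron :: "'a :: semiring_0 mat \<Rightarrow> 'a mat \<Rightarrow> 'a mat"  (infixr "\<otimes>\<^sub>K" 72) where
  "kron A B = mat (dim_row A * dim_row B) (dim_col A * dim_col B)
     (\<lambda>(r, c). A $$ (r div dim_row B, c div dim_col B) * B $$ (r mod dim_row B, c mod dim_col B))"

(* kron_prod X d = X 1 \<otimes> \<dots> \<otimes> X d, families being indexed from 1 *)
primrec kron_prod :: "(nat \<Rightarrow> 'a :: semiring_1 mat) \<Rightarrow> nat \<Rightarrow> 'a mat" where
  "kron_prod X 0 = 1\<^sub>m 1"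
| "kron_prod X (Suc k) = kron_prod X k \<otimes>\<^sub>K X (Suc k)"

(* The sum of a finite family of N \<times> N matrices; matrices of variable size do not form
   an additive monoid, so the sum is taken entrywise. *)
definition mat_sum :: "nat \<Rightarrow> ('i \<Rightarrow> 'a :: comm_monoid_add mat) \<Rightarrow> 'i set \<Rightarrow> 'a mat" where
  "mat_sum N F I = mat N N (\<lambda>(r, c). \<Sum>i\<in>I. F i $$ (r, c))"

definition gtilde :: "real \<Rightarrow> nat \<Rightarrow> real" where
  "gtilde \<alpha> k = (-1) ^ k * (\<alpha> gchoose k)"

(* Matrix indices start at 0 here, which leaves the differences j - k unchanged;
   j - k \<ge> -1 is written without truncated subtraction. *)
definition Ltilde :: "real \<Rightarrow> nat \<Rightarrow> real mat" where
  "Ltilde \<alpha> m = mat m m (\<lambda>(j, k). if k \<le> j + 1 then - gtilde \<alpha> (j + 1 - k) else 0)"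

definition sym_part :: "real mat \<Rightarrow> real mat" where
  "sym_part Z = (1/2) \<cdot>\<^sub>m (Z + Z\<^sup>T)"

(* The m \<times> m Hankel matrix with first column u and last column w (where u_{m-1} = w_0). *)
definition hankel :: "nat \<Rightarrow> real vec \<Rightarrow> real vec \<Rightarrow> real mat" where
  "hankel m u w = mat m m (\<lambda>(j, k). if j + k < m then u $ (j + k) else w $ (j + k + 1 - m))"

(* Meant for symmetric Toeplitz S, with first column (t_1, ..., t_m), so that
   t_l = S $$ (l - 1, 0).  The two vectors are (t_3, ..., t_m, 0, 0) and
   (0, 0, t_m, ..., t_3), truncated to (0) if m = 1. *)
definition tau_mat :: "real mat \<Rightarrow> real mat" where
  "tau_mat S = (let m = dim_row S in
     S - hankel m
       (vec m (\<lambda>j. if j + 2 < m then S $$ (j + 2, 0) else 0))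
       (vec m (\<lambda>j. if 2 \<le> j then S $$ (m + 1 - j, 0) else 0)))"

(* [Y_m]_{j,k} = 1 iff j + k = m + 1 for indices starting at 1 *)
definition anti_id :: "nat \<Rightarrow> 'a :: zero_neq_one mat" where
  "anti_id m = mat m m (\<lambda>(j, k). if j + k + 1 = m then 1 else 0)"

definition total_dim :: "nat \<Rightarrow> (nat \<Rightarrow> nat) \<Rightarrow> nat" where
  "total_dim d n = (\<Prod>i\<in>{1..d}. n i)"

(* I_{n_i^-} \<otimes> X \<otimes> I_{n_i^+} *)
definition lift_dir :: "nat \<Rightarrow> (nat \<Rightarrow> nat) \<Rightarrow> nat \<Rightarrow> real mat \<Rightarrow> real mat" where
  "lift_dir d n i X = 1\<^sub>m (\<Prod>j\<in>{1..<i}. n j) \<otimes>\<^sub>K X \<otimes>\<^sub>K 1\<^sub>m (\<Prod>j\<in>{i<..d}. n j)"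

definition Wtilde :: "nat \<Rightarrow> (nat \<Rightarrow> nat) \<Rightarrow> (nat \<Rightarrow> real) \<Rightarrow> nat \<Rightarrow> real mat" where
  "Wtilde d n \<alpha> i = lift_dir d n i (Ltilde (\<alpha> i) (n i))"

definition Atilde ::
  "nat \<Rightarrow> (nat \<Rightarrow> nat) \<Rightarrow> (nat \<Rightarrow> real) \<Rightarrow> real \<Rightarrow> (nat \<Rightarrow> real) \<Rightarrow> (nat \<Rightarrow> real) \<Rightarrow> real mat" where
  "Atilde d n \<alpha> \<nu> vp vm = \<nu> \<cdot>\<^sub>m 1\<^sub>m (total_dim d n) +
     mat_sum (total_dim d n)
       (\<lambda>i. vp i \<cdot>\<^sub>m Wtilde d n \<alpha> i + vm i \<cdot>\<^sub>m (Wtilde d n \<alpha> i)\<^sup>T) {1..d}"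

definition Ptilde ::
  "nat \<Rightarrow> (nat \<Rightarrow> nat) \<Rightarrow> (nat \<Rightarrow> real) \<Rightarrow> real \<Rightarrow> (nat \<Rightarrow> real) \<Rightarrow> (nat \<Rightarrow> real) \<Rightarrow> real mat" where
  "Ptilde d n \<alpha> \<nu> vp vm = \<nu> \<cdot>\<^sub>m 1\<^sub>m (total_dim d n) +
     mat_sum (total_dim d n)
       (\<lambda>i. (vp i + vm i) \<cdot>\<^sub>m lift_dir d n i (tau_mat (sym_part (Ltilde (\<alpha> i) (n i))))) {1..d}"

definition Y_mat :: "nat \<Rightarrow> (nat \<Rightarrow> nat) \<Rightarrow> real mat" where
  "Y_mat d n = kron_prod (\<lambda>i. anti_id (n i)) d"

end

theory Submission
  imports Defs "HOL-Analysis.Generalised_Binomial_Theorem"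
begin

text \<open>
  Both $Y_n\widetilde A_n$ and $\widetilde P_n$ are symmetric and $\widetilde P_n$ commutes with
  $Y_n$, so an eigenpair satisfies $Y_n\widetilde A_n u = s\,\widetilde P_n u$ with $s$ and $u$ real.
  Testing with $u$ and with $Y_nu$ reduces the claim to bounds for the quadratic forms of the
  one-dimensional blocks. For the symmetric part $T$ of $\widetilde L$ and its Hankel correction
  $H = T - \tau(T)$, the matrices $T + H$ and $T - 3H$ are diagonally dominant, which gives
  $\frac12\tau(T) \le T \le \frac32\tau(T)$. The skew part is controlled by the sector that contains
  the range of the generating function $-e^{-i\theta}(1-e^{i\theta})^\alpha$, transferred to the
  Toeplitz matrix by averaging a truncated symbol over roots of unity. Strict inequalities come
  from $\nu > 0$, and a suitable $\epsilon$ exists because there are only finitely many eigenvalues.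
\<close>

subsection \<open>The generating function of the coefficients\<close>

text \<open>The obstacle is that u^T Y A u is a mixed form in two different vectors, Yu and u, while
  the comparison with the tau matrix concerns quadratic forms. With y = Yu, the symmetric part of
  the mixed form is bounded by polarization, and the skew part because it is the imaginary part of
  the Hermitian form at the complex vector y + i u. Both bounds involve only the quadratic forms at
  u and y, and invariance of P under Y turns those back into the form of P at u. So the argument
  runs on forms alone, without a square root of P. The constants have separate origins: 1/2 and 3/2
  are the two sides of the tau comparison, and 1 + e is the cost of the skew part, with e the
  maximum in the statement. The \<nu> terms have ratio 1, strictly between 1/2 and 3/2 (1 + e).
  Averaging over roots of unity keeps all sums finite: truncation is the only error, and it vanishes
  because the coefficients are absolutely summable.\<close>

lemma gtilde_0 [simp]: "gtilde \<alpha> 0 = 1"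
  by (simp add: gtilde_def)

lemma gtilde_Suc: "gtilde \<alpha> (Suc k) = gtilde \<alpha> k * ((real k - \<alpha>) / (real k + 1))"
proof -
  have "\<alpha> gchoose Suc k = (\<alpha> gchoose k) * ((\<alpha> - real k) / (real k + 1))"
    by (simp add: gbinomial_prod_rev add.commute)
  thus ?thesis unfolding gtilde_def by (simp only: power_Suc) (simp add: divide_simps right_diff_distrib)
qed

lemma gtilde_1: "gtilde \<alpha> (Suc 0) = - \<alpha>"
  by (simp add: gtilde_Suc)

lemma gtilde_pos:
  assumes "1 < \<alpha>" "\<alpha> < 2"
  shows "gtilde \<alpha> (k + 2) > 0"
proof (induction k)
  case 0
  show ?case using assms by (simp add: gtilde_Suc numeral_2_eq_2 mult_pos_neg)
next
  case (Suc k)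
  have "gtilde \<alpha> (Suc k + 2) = gtilde \<alpha> (k + 2) * ((real (k + 2) - \<alpha>) / (real (k + 2) + 1))"
    using gtilde_Suc[of \<alpha> "k + 2"] by simp
  thus ?case using Suc assms by simp
qed

text \<open>From index 2 on, the ratio (k - \<alpha>)/(k + 1) of consecutive coefficients lies
  between 0 and 1. The monotonicity later dominates Hankel entries by Toeplitz entries.\<close>

lemma gtilde_decreasing:
  assumes "1 < \<alpha>" "\<alpha> < 2" "2 \<le> k" "k \<le> l"
  shows "gtilde \<alpha> l \<le> gtilde \<alpha> k"
  using assms(4)
proof (induction l rule: dec_induct)
  case (step l)
  obtain l' where l': "l = l' + 2"
    using step assms(3) by (metis le_add_diff_inverse2 le_trans)
  have "gtilde \<alpha> (Suc l) \<le> gtilde \<alpha> l"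
    unfolding gtilde_Suc l' using gtilde_pos[OF assms(1,2), of l'] assms(1,2)
    by (simp add: mult_le_cancel_left1 divide_le_eq)
  thus ?case using step by simp
qed simp

text \<open>Partial summation multiplies the generating function (1 - z)^\<alpha> by 1/(1 - z),
  which leaves (1 - z)^(\<alpha> - 1).\<close>

lemma gtilde_sum: "(\<Sum>k\<le>m. gtilde \<alpha> k) = gtilde (\<alpha> - 1) m"
  using gbinomial_sum_lower_neg[of \<alpha> m] by (simp add: gtilde_def mult.commute)

lemma gtilde_sum_nonpos:
  assumes "1 < \<alpha>" "\<alpha> < 2" "m \<ge> 1"
  shows "(\<Sum>k\<le>m. gtilde \<alpha> k) \<le> 0"
  unfolding gtilde_sum using assms(3)
proof (induction m rule: dec_induct)
  case base
  show ?case using assms by (simp add: gtilde_Suc)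
next
  case (step m)
  have "(real m - (\<alpha> - 1)) / (real m + 1) \<ge> 0" using step assms by simp
  thus ?case unfolding gtilde_Suc using step.IH by (intro mult_nonpos_nonneg)
qed

text \<open>From index 2 on the terms are positive, and nonpositivity of the full partial sums keeps
  their sum below -(1 - \<alpha>).\<close>

lemma summable_abs_gtilde:
  assumes "1 < \<alpha>" "\<alpha> < 2"
  shows "summable (\<lambda>k. \<bar>gtilde \<alpha> k\<bar>)"
proof -
  have "summable (\<lambda>k. gtilde \<alpha> (k + 2))"
  proof (rule summableI_nonneg_bounded)
    fix n
    show "0 \<le> gtilde \<alpha> (n + 2)" using gtilde_pos[OF assms] less_imp_le by blast
    have "(\<Sum>k\<le>Suc n. gtilde \<alpha> k) = 1 - \<alpha> + (\<Sum>k<n. gtilde \<alpha> (k + 2))"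
      by (subst lessThan_Suc_atMost[symmetric])
        (simp add: sum.lessThan_Suc_shift gtilde_1 del: sum.lessThan_Suc)
    thus "(\<Sum>k<n. gtilde \<alpha> (k + 2)) \<le> \<alpha> - 1"
      using gtilde_sum_nonpos[OF assms, of "Suc n"] by simp
  qed
  hence "summable (\<lambda>k. \<bar>gtilde \<alpha> (k + 2)\<bar>)"
    using gtilde_pos[OF assms] by (simp add: abs_of_pos)
  thus ?thesis by (subst (asm) summable_iff_shift)
qed

text \<open>The binomial series is used in the open disc only. Absolute summability gives uniform
  convergence on the closed disc, so both sides can be followed along the radius to w.\<close>

lemma gtilde_series:
  fixes w :: complex
  assumes \<alpha>: "1 < \<alpha>" "\<alpha> < 2" and w: "norm w = 1" "w \<noteq> 1"
  shows "(\<Sum>s. of_real (gtilde \<alpha> s) * w ^ s) = (1 - w) powr of_real \<alpha>"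
proof -
  define G where "G = (\<lambda>z. \<Sum>s. of_real (gtilde \<alpha> s) * z ^ s :: complex)"
  have bnd: "norm (of_real (gtilde \<alpha> s) * z ^ s) \<le> \<bar>gtilde \<alpha> s\<bar>"
    if "z \<in> cball 0 1" for s and z :: complex
    using that by (auto simp: norm_mult norm_power intro!: mult_left_le power_le_one)
  have "uniform_limit (cball 0 1) (\<lambda>n z. \<Sum>s<n. of_real (gtilde \<alpha> s) * z ^ s) G sequentially"
    unfolding G_def by (rule Weierstrass_m_test[OF bnd summable_abs_gtilde[OF \<alpha>]])
  hence cont: "continuous_on (cball 0 1) G"
    by (rule uniform_limit_theorem[rotated]) (auto intro!: always_eventually continuous_intros)
  define r where "r = (\<lambda>n. real n / real (Suc n))"
  have r: "0 \<le> r n" "r n < 1" for n by (simp_all add: r_def)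
  have lim: "(\<lambda>n. of_real (r n) * w) \<longlonglongrightarrow> w"
    using tendsto_mult[OF tendsto_of_real[OF LIMSEQ_n_over_Suc_n] tendsto_const, of w]
    by (simp add: r_def)
  have nr: "norm (of_real (r n) * w) < 1" for n using r[of n] w by (simp add: norm_mult)
  have gb: "of_real (\<alpha> gchoose s) = (complex_of_real \<alpha> gchoose s)" for s
    by (simp add: gbinomial_prod_rev)
  have "G (of_real (r n) * w) = (1 - of_real (r n) * w) powr of_real \<alpha>" for n
  proof -
    have "(\<lambda>s. (of_real \<alpha> gchoose s) * (- (of_real (r n) * w)) ^ s)
            sums (1 + - (of_real (r n) * w)) powr of_real \<alpha>"
      using nr[of n] by (intro gen_binomial_complex) simp
    moreover have "(of_real \<alpha> gchoose s) * (- (of_real (r n) * w)) ^ s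
        = of_real (gtilde \<alpha> s) * (of_real (r n) * w) ^ s" for s
      by (simp add: gtilde_def gb power_minus[of "of_real (r n) * w"])
    ultimately show ?thesis by (simp add: G_def sums_iff)
  qed
  moreover have "(\<lambda>n. G (of_real (r n) * w)) \<longlonglongrightarrow> G w"
    using w nr by (intro continuous_on_tendsto_compose[OF cont lim]) (auto intro!: always_eventually simp: less_imp_le)
  moreover have "(\<lambda>n. (1 - of_real (r n) * w) powr of_real \<alpha>) \<longlonglongrightarrow> (1 - w) powr of_real \<alpha>"
  proof -
    \<comment> \<open>This keeps 1 - w off the branch cut of \<open>powr\<close>, so the right-hand
      side is continuous there.\<close>
    have "Re w < 1"
    proof -
      have "(Re w)\<^sup>2 + (Im w)\<^sup>2 = 1" using w(1) by (simp add: cmod_def)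
      hence "Re w = 1 \<Longrightarrow> Im w = 0" by simp
      moreover have "Re w \<le> 1" using complex_Re_le_cmod[of w] w(1) by simp
      ultimately show ?thesis using w(2) by (cases "Re w = 1") (auto simp: complex_eq_iff)
    qed
    hence "1 - w \<notin> \<real>\<^sub>\<le>\<^sub>0" by (auto simp: complex_nonpos_Reals_iff)
    thus ?thesis by (intro tendsto_powr_complex tendsto_intros lim)
  qed
  ultimately have "G w = (1 - w) powr of_real \<alpha>"
    by (metis (no_types, lifting) LIMSEQ_unique ext)
  thus ?thesis by (simp add: G_def)
qed

section \<open>Argument of the symbol on the unit circle\<close>

lemma one_minus_cis: "1 - cis \<theta> = of_real (2 * sin (\<theta> / 2)) * cis ((\<theta> - pi) / 2)"
proof -
  have 1: "cos ((\<theta> - pi) / 2) = sin (\<theta> / 2)" "sin ((\<theta> - pi) / 2) = - cos (\<theta> / 2)"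
    by (simp_all add: diff_divide_distrib cos_diff sin_diff)
  have "cos \<theta> = 1 - 2 * sin (\<theta> / 2) ^ 2" "sin \<theta> = 2 * sin (\<theta> / 2) * cos (\<theta> / 2)"
    using cos_double_sin[of "\<theta> / 2"] sin_double[of "\<theta> / 2"] by simp_all
  thus ?thesis by (simp add: complex_eq_iff 1 power2_eq_square)
qed

lemma powr_of_real_mult_cis:
  assumes "r > 0" "-pi < \<phi>" "\<phi> \<le> pi"
  shows "(of_real r * cis \<phi>) powr of_real a = of_real (r powr a) * cis (a * \<phi>)"
proof -
  have "of_real r * cis \<phi> = exp (Complex (ln r) \<phi>)"
    using assms(1) by (simp add: exp_eq_polar exp_of_real)
  hence "Ln (of_real r * cis \<phi>) = Complex (ln r) \<phi>"
    using assms by simp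
  moreover have "of_real r * cis \<phi> \<noteq> 0" using assms by simp
  moreover have "exp (of_real a * Complex (ln r) \<phi>) = of_real (r powr a) * cis (a * \<phi>)"
    using assms by (simp add: exp_eq_polar powr_def)
  ultimately show ?thesis by (simp add: powr_def)
qed

text \<open>On the unit circle \<open>cnj w\<close> is 1/w, so the coefficient of w^(j - k) is the
  (j, k) entry of \<open>Ltilde\<close>. The series is kept, rather than the closed power, because
  it is compared with its own truncations.\<close>

definition symbol :: "real \<Rightarrow> complex \<Rightarrow> complex" where
  "symbol \<alpha> w = - cnj w * (\<Sum>s. of_real (gtilde \<alpha> s) * w ^ s)"

text \<open>On the unit circle the symbol equals $(2\sin(\theta/2))^\alpha e^{i(1-\alpha/2)(\pi-\theta)}$
  at $w = e^{i\theta}$, so its argument is at most $(1-\alpha/2)\pi$ in absolute value.\<close>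

lemma symbol_sector:
  assumes \<alpha>: "1 < \<alpha>" "\<alpha> < 2" and w: "norm w = 1"
  shows "\<bar>Im (symbol \<alpha> w)\<bar> \<le> \<bar>tan (\<alpha> / 2 * pi)\<bar> * Re (symbol \<alpha> w)"
proof (cases "w = 1")
  case True
  have sm: "summable (gtilde \<alpha>)"
    using summable_abs_gtilde[OF \<alpha>] by (rule summable_rabs_cancel)
  have le: "suminf (gtilde \<alpha>) \<le> 0"
  proof (rule LIMSEQ_le_const2[OF summable_LIMSEQ'[OF sm]])
    show "\<exists>N. \<forall>n\<ge>N. (\<Sum>k\<le>n. gtilde \<alpha> k) \<le> 0"
      using gtilde_sum_nonpos[OF \<alpha>] by blast
  qed
  have "symbol \<alpha> w = of_real (- suminf (gtilde \<alpha>))"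
    using sm by (simp add: symbol_def True suminf_of_real)
  thus ?thesis using le by (simp add: mult_nonneg_nonpos)
next
  case False
  \<comment> \<open>The branch [0, 2 pi) makes sin (\<theta> / 2) positive and puts (\<theta> - pi)
    / 2 into the principal range, so that \<open>powr\<close> simply multiplies this angle by
    \<alpha>.\<close>
  define \<theta> where "\<theta> = Arg2pi w"
  have wth: "w = cis \<theta>" and th0: "0 \<le> \<theta>" and th2: "\<theta> < 2 * pi"
    using Arg2pi[of w] w by (auto simp: \<theta>_def cis_conv_exp is_Arg_def)
  have th1: "0 < \<theta>" using th0 False wth by (cases "\<theta> = 0") auto
  define R where "R = (2 * sin (\<theta> / 2)) powr \<alpha>"
  have sin: "sin (\<theta> / 2) > 0" using th1 th2 by (intro sin_gt_zero) auto
  have R: "R \<ge> 0" by (simp add: R_def)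
  define \<psi> \<gamma> where "\<psi> = (1 - \<alpha> / 2) * (pi - \<theta>)" and "\<gamma> = (1 - \<alpha> / 2) * pi"
  have cnj: "- cnj (cis \<theta>) = cis (pi - \<theta>)"
    by (simp add: complex_eq_iff cos_diff sin_diff)
  have "symbol \<alpha> w = cis (pi - \<theta>) * (of_real R * cis (\<alpha> * ((\<theta> - pi) / 2)))"
    unfolding symbol_def gtilde_series[OF \<alpha> w False]
    unfolding wth one_minus_cis R_def
    using sin th1 th2 by (subst powr_of_real_mult_cis) (simp_all add: cnj)
  also have "\<dots> = of_real R * cis (pi - \<theta> + \<alpha> * ((\<theta> - pi) / 2))"
    by (simp flip: cis_mult)
  also have "pi - \<theta> + \<alpha> * ((\<theta> - pi) / 2) = \<psi>"
    by (simp add: \<psi>_def field_simps)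
  finally have sy: "Re (symbol \<alpha> w) = R * cos \<psi>" "Im (symbol \<alpha> w) = R * sin \<psi>"
    by simp_all
  have \<gamma>: "0 < \<gamma>" "\<gamma> < pi / 2" using \<alpha> by (auto simp: \<gamma>_def algebra_simps)
  have \<psi>: "- \<gamma> \<le> \<psi>" "\<psi> \<le> \<gamma>"
  proof -
    have "(1 - \<alpha> / 2) * (-pi) \<le> (1 - \<alpha> / 2) * (pi - \<theta>)"
      using \<alpha> th2 by (intro mult_left_mono) auto
    thus "- \<gamma> \<le> \<psi>" by (simp add: \<gamma>_def \<psi>_def)
    have "(1 - \<alpha> / 2) * (pi - \<theta>) \<le> (1 - \<alpha> / 2) * pi"
      using \<alpha> th1 by (intro mult_left_mono) auto
    thus "\<psi> \<le> \<gamma>" by (simp add: \<gamma>_def \<psi>_def)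
  qed
  have cg: "cos \<gamma> > 0" using \<gamma> by (intro cos_gt_zero_pi) auto
  \<comment> \<open>Both arguments lie in [0, 2 \<gamma>], inside [0, pi]. The addition formulas
    turn this into the tangent bound for either sign of sin \<psi>.\<close>
  have "sin (\<gamma> - \<psi>) \<ge> 0" "sin (\<gamma> + \<psi>) \<ge> 0"
    using \<gamma> \<psi> by (auto intro!: sin_ge_zero)
  hence "\<bar>sin \<psi>\<bar> * cos \<gamma> \<le> sin \<gamma> * cos \<psi>"
    by (auto simp: sin_diff sin_add abs_if mult.commute)
  hence "\<bar>sin \<psi>\<bar> \<le> tan \<gamma> * cos \<psi>"
    using cg by (simp add: tan_def field_simps)
  hence "R * \<bar>sin \<psi>\<bar> \<le> R * (tan \<gamma> * cos \<psi>)"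
    using R by (rule mult_left_mono)
  moreover have "\<bar>tan (\<alpha> / 2 * pi)\<bar> = tan \<gamma>"
  proof -
    have "\<gamma> = pi - \<alpha> / 2 * pi" by (simp add: \<gamma>_def algebra_simps)
    hence "tan \<gamma> = - tan (\<alpha> / 2 * pi)" by (simp add: tan_def)
    moreover have "tan \<gamma> > 0" using \<gamma> by (rule tan_gt_zero)
    ultimately show ?thesis by simp
  qed
  ultimately show ?thesis using R by (simp add: sy abs_mult mult.left_commute)
qed

text \<open>Discrete counterpart of the orthogonality of exponentials. Exponents below N exclude
  aliasing, that is, distinct exponents congruent modulo N.\<close>

lemma sum_roots_of_unity_orthogonal:
  fixes s t N :: nat
  assumes "s < N" "t < N"
  shows "(\<Sum>j<N. cis (2 * pi * real j / real N) ^ s * cnj (cis (2 * pi * real j / real N)) ^ t)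
       = (if s = t then of_nat N else 0)"
proof -
  define q where "q = cis (2 * pi * (real s - real t) / real N)"
  have N: "N > 0" using assms by simp
  have "cis (2 * pi * real j / real N) ^ s * cnj (cis (2 * pi * real j / real N)) ^ t = q ^ j" for j
    by (simp add: q_def cis_cnj Complex.DeMoivre cis_mult algebra_simps add_divide_distrib
        diff_divide_distrib)
  hence eq: "(\<Sum>j<N. cis (2 * pi * real j / real N) ^ s * cnj (cis (2 * pi * real j / real N)) ^ t)
      = (\<Sum>j<N. q ^ j)" by simp
  show ?thesis
  proof (cases "s = t")
    case True
    thus ?thesis unfolding eq by (simp add: q_def)
  next
    case False
    have "q ^ N = cis (2 * pi * of_int (int s - int t))"
      using N by (simp add: q_def Complex.DeMoivre)
    hence qN: "q ^ N = 1" by simp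
    have "q \<noteq> 1"
    proof
      assume "q = 1"
      hence "cos (2 * pi * (real s - real t) / real N) = 1" by (simp add: q_def complex_eq_iff)
      then obtain k :: int where k: "2 * pi * (real s - real t) / real N = of_int k * 2 * pi"
        by (auto simp: cos_one_2pi_int)
      hence "real_of_int (int s - int t) = of_int (k * int N)"
        using N by (simp add: divide_simps mult.assoc mult.left_commute[of _ 2] flip: right_diff_distrib)
      hence "int s - int t = k * int N" using of_int_eq_iff by blast
      hence "int N dvd \<bar>int s - int t\<bar>" by simp
      moreover have "\<bar>int s - int t\<bar> < int N" using assms by linarith
      moreover have "\<bar>int s - int t\<bar> > 0" using False by simp
      ultimately show False using zdvd_not_zless by blast
    qed
    thus ?thesis unfolding eq using False qN by (simp add: geometric_sum)
  qed
qed

subsection \<open>The numerical range of the Toeplitz matrix\<close>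

text \<open>Vectors are plain functions of which only the values below N count, so slices and
  reversals need no dimension bookkeeping.\<close>

definition form :: "nat \<Rightarrow> real mat \<Rightarrow> (nat \<Rightarrow> real) \<Rightarrow> (nat \<Rightarrow> real) \<Rightarrow> real" where
  "form N A x y = (\<Sum>j<N. \<Sum>k<N. x j * A $$ (j, k) * y k)"

text \<open>The exponents s + k and l + 1 stay below K + m, so the average over the (K + m)-th roots
  of unity extracts coefficients exactly: only s = l + 1 - k survives, which yields the Toeplitz
  entry. By m < K every such s belongs to the truncated sum.\<close>

lemma Ltilde_form_average:
  fixes z :: "nat \<Rightarrow> complex"
  assumes K: "m < K"
  defines "w \<equiv> \<lambda>j. cis (2 * pi * real j / real (K + m))"
  shows "of_nat (K + m) * (\<Sum>l<m. \<Sum>k<m. cnj (z l) * of_real (Ltilde \<alpha> m $$ (l, k)) * z k)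
    = (\<Sum>j<K + m. (- cnj (w j) * (\<Sum>s<K. of_real (gtilde \<alpha> s) * w j ^ s))
          * of_real ((norm (\<Sum>k<m. z k * w j ^ k))\<^sup>2))"
    (is "?L = ?R")
proof -
  define c where "c = (\<lambda>s l k. - of_real (gtilde \<alpha> s) * z k * cnj (z l))"
  have "?R = (\<Sum>j<K + m. \<Sum>s<K. \<Sum>k<m. \<Sum>l<m. c s l k * (w j ^ (s + k) * cnj (w j) ^ Suc l))"
  proof (rule sum.cong[OF refl])
    fix j
    have "of_real ((norm (\<Sum>k<m. z k * w j ^ k))\<^sup>2)
        = (\<Sum>k<m. \<Sum>l<m. z k * w j ^ k * (cnj (z l) * cnj (w j) ^ l))"
      unfolding complex_norm_square by (simp add: sum_product)
    thus "(- cnj (w j) * (\<Sum>s<K. of_real (gtilde \<alpha> s) * w j ^ s))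
          * of_real ((norm (\<Sum>k<m. z k * w j ^ k))\<^sup>2)
        = (\<Sum>s<K. \<Sum>k<m. \<Sum>l<m. c s l k * (w j ^ (s + k) * cnj (w j) ^ Suc l))"
      by (simp add: sum_distrib_left sum_distrib_right c_def power_add mult_ac
          sum_negf sum.swap[of _ _ "{..<K}"] cong: sum.cong)
  qed
  also have "\<dots> = (\<Sum>s<K. \<Sum>k<m. \<Sum>l<m. c s l k * (\<Sum>j<K + m. w j ^ (s + k) * cnj (w j) ^ Suc l))"
    by (simp only: sum.swap[of _ _ "{..<K + m}"] sum_distrib_left)
  also have "\<dots> = (\<Sum>s<K. \<Sum>k<m. \<Sum>l<m. c s l k * (if s + k = Suc l then of_nat (K + m) else 0))"
    unfolding w_def using K
    by (intro sum.cong refl, subst sum_roots_of_unity_orthogonal) auto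
  also have "\<dots> = (\<Sum>k<m. \<Sum>l<m. \<Sum>s<K. if s + k = Suc l then c s l k * of_nat (K + m) else 0)"
    by (simp only: sum.swap[of _ _ "{..<K}"] if_distrib[of "\<lambda>x. _ * x"] mult_zero_right)
  also have "\<dots> = (\<Sum>k<m. \<Sum>l<m. of_nat (K + m) * (cnj (z l) * of_real (Ltilde \<alpha> m $$ (l, k)) * z k))"
  proof (intro sum.cong refl)
    fix k l assume kl: "k \<in> {..<m}" "l \<in> {..<m}"
    have "(\<Sum>s<K. if s + k = Suc l then c s l k * of_nat (K + m) else 0)
        = (\<Sum>s<K. if s = Suc l - k then (if k \<le> Suc l then c s l k * of_nat (K + m) else 0) else 0)"
      by (intro sum.cong) auto
    also have "\<dots> = (if k \<le> Suc l then c (Suc l - k) l k * of_nat (K + m) else 0)"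
      using K kl by auto
    finally show "(\<Sum>s<K. if s + k = Suc l then c s l k * of_nat (K + m) else 0)
        = of_nat (K + m) * (cnj (z l) * of_real (Ltilde \<alpha> m $$ (l, k)) * z k)"
      using kl by (simp add: Ltilde_def c_def)
  qed
  also have "\<dots> = ?L"
    by (subst sum.swap) (simp add: sum_distrib_left)
  finally show ?thesis ..
qed

text \<open>By the averaging identity, Z is a nonnegative combination of values of the truncated
  symbol. These lie within \<open>tail K\<close> of the sector, and K tends to infinity.\<close>

lemma Ltilde_numerical_range:
  fixes z :: "nat \<Rightarrow> complex" and m :: nat
  assumes \<alpha>: "1 < \<alpha>" "\<alpha> < 2"
  defines "Z \<equiv> \<Sum>l<m. \<Sum>k<m. cnj (z l) * of_real (Ltilde \<alpha> m $$ (l, k)) * z k"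
  shows "\<bar>Im Z\<bar> \<le> \<bar>tan (\<alpha> / 2 * pi)\<bar> * Re Z"
proof -
  define t where "t = \<bar>tan (\<alpha> / 2 * pi)\<bar>"
  have t: "t \<ge> 0" by (simp add: t_def)
  define tail where "tail = (\<lambda>K. \<Sum>s. \<bar>gtilde \<alpha> (s + K)\<bar>)"
  define B where "B = (\<Sum>k<m. norm (z k))\<^sup>2"
  have main: "t * Re Z + \<sigma> * Im Z \<ge> - ((t + 1) * tail K * B)"
    if \<sigma>: "\<bar>\<sigma>\<bar> = 1" and K: "m < K" for \<sigma> :: real and K
  proof -
    define w where "w = (\<lambda>j. cis (2 * pi * real j / real (K + m)))"
    define F where "F = (\<lambda>j. - cnj (w j) * (\<Sum>s<K. of_real (gtilde \<alpha> s) * w j ^ s))"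
    define p where "p = (\<lambda>j. (norm (\<Sum>k<m. z k * w j ^ k))\<^sup>2)"
    \<comment> \<open>The sector is the intersection of the half-planes \<Phi> \<ge> 0 for \<sigma>
      = 1 and \<sigma> = -1. Being linear, \<Phi> passes through the average.\<close>
    define \<Phi> where "\<Phi> = (\<lambda>x. t * Re x + \<sigma> * Im x)"
    have nw: "norm (w j) = 1" for j by (simp add: w_def)
    have sms: "summable (\<lambda>s. of_real (gtilde \<alpha> s) * w j ^ s)" for j
      by (rule summable_norm_cancel)
        (use summable_abs_gtilde[OF \<alpha>] nw[of j] in \<open>simp add: norm_mult norm_power\<close>)
    have smt: "summable (\<lambda>s. \<bar>gtilde \<alpha> (s + K)\<bar>)"
      using summable_abs_gtilde[OF \<alpha>] by (subst summable_iff_shift)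
    have dist: "norm (F j - symbol \<alpha> (w j)) \<le> tail K" for j
    proof -
      have "F j - symbol \<alpha> (w j) = cnj (w j) * (\<Sum>s. of_real (gtilde \<alpha> (s + K)) * w j ^ (s + K))"
        unfolding F_def symbol_def using suminf_split_initial_segment[OF sms[of j], of K]
        by (simp add: algebra_simps)
      also have "norm \<dots> = norm (\<Sum>s. of_real (gtilde \<alpha> (s + K)) * w j ^ (s + K))"
        by (simp add: norm_mult nw)
      also have "\<dots> \<le> (\<Sum>s. norm (of_real (gtilde \<alpha> (s + K)) * w j ^ (s + K)))"
        using smt by (intro summable_norm) (simp add: norm_mult norm_power nw)
      also have "\<dots> = tail K" by (simp add: tail_def norm_mult norm_power nw)
      finally show ?thesis .
    qed
    have \<Phi>F: "\<Phi> (F j) \<ge> - ((t + 1) * tail K)" for j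
    proof -
      have sec: "\<bar>Im (symbol \<alpha> (w j))\<bar> \<le> t * Re (symbol \<alpha> (w j))"
        unfolding t_def by (rule symbol_sector[OF \<alpha> nw])
      have s2: "\<bar>\<sigma> * x\<bar> = \<bar>x\<bar>" for x using \<sigma> by (simp add: abs_mult)
      have "0 \<le> \<Phi> (symbol \<alpha> (w j))"
        unfolding \<Phi>_def using sec s2[of "Im (symbol \<alpha> (w j))"] by linarith
      moreover have "\<bar>\<Phi> (F j - symbol \<alpha> (w j))\<bar> \<le> (t + 1) * tail K"
      proof -
        let ?u = "F j - symbol \<alpha> (w j)"
        have "\<bar>\<Phi> ?u\<bar> \<le> \<bar>t * Re ?u\<bar> + \<bar>Im ?u\<bar>"
          unfolding \<Phi>_def using s2[of "Im ?u"] by linarith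
        also have "\<dots> \<le> t * norm ?u + norm ?u"
          using t abs_Re_le_cmod[of ?u] abs_Im_le_cmod[of ?u]
          by (intro add_mono) (auto simp: abs_mult intro!: mult_left_mono)
        also have "\<dots> = (t + 1) * norm ?u" by (simp add: algebra_simps)
        also have "\<dots> \<le> (t + 1) * tail K" using t dist by (intro mult_left_mono) auto
        finally show ?thesis .
      qed
      moreover have "\<Phi> (F j) = \<Phi> (symbol \<alpha> (w j)) + \<Phi> (F j - symbol \<alpha> (w j))"
        by (simp add: \<Phi>_def algebra_simps)
      ultimately show ?thesis by linarith
    qed
    \<comment> \<open>The weights are bounded independently of K, so the truncation error vanishes
      together with \<open>tail K\<close>.\<close>
    have pB: "p j \<le> B" for j
    proof -
      have "norm (\<Sum>k<m. z k * w j ^ k) \<le> (\<Sum>k<m. norm (z k))"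
        by (rule order_trans[OF norm_sum]) (simp add: norm_mult norm_power nw)
      thus ?thesis unfolding p_def B_def by (intro power_mono) auto
    qed
    have tail0: "tail K \<ge> 0" unfolding tail_def using smt by (intro suminf_nonneg) auto
    have lower: "- ((t + 1) * tail K * B) \<le> \<Phi> (F j) * p j" for j
    proof -
      have "(t + 1) * tail K * p j \<le> (t + 1) * tail K * B"
        using pB[of j] tail0 t by (intro mult_left_mono) auto
      moreover have "- ((t + 1) * tail K) * p j \<le> \<Phi> (F j) * p j"
        using \<Phi>F[of j] by (intro mult_right_mono) (auto simp: p_def)
      ultimately show ?thesis by simp
    qed
    have "of_nat (K + m) * Z = (\<Sum>j<K + m. F j * of_real (p j))"
      unfolding Z_def F_def p_def w_def by (rule Ltilde_form_average[OF K])
    hence "\<Phi> (of_nat (K + m) * Z) = \<Phi> (\<Sum>j<K + m. F j * of_real (p j))" by simp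
    also have "\<dots> = (\<Sum>j<K + m. \<Phi> (F j) * p j)"
      by (simp add: \<Phi>_def sum_distrib_left sum.distrib algebra_simps)
    finally have "real (K + m) * \<Phi> Z = (\<Sum>j<K + m. \<Phi> (F j) * p j)"
      by (simp add: \<Phi>_def algebra_simps)
    also have "\<dots> \<ge> (\<Sum>j<K + m. - ((t + 1) * tail K * B))"
      by (intro sum_mono lower)
    finally have "real (K + m) * (- ((t + 1) * tail K * B)) \<le> real (K + m) * \<Phi> Z" by simp
    thus ?thesis using K by (subst (asm) mult_le_cancel_left_pos) (auto simp: \<Phi>_def)
  qed
  have "tail \<longlonglongrightarrow> 0"
  proof -
    have "tail = (\<lambda>K. (\<Sum>s. \<bar>gtilde \<alpha> s\<bar>) - (\<Sum>s<K. \<bar>gtilde \<alpha> s\<bar>))"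
      unfolding tail_def by (rule ext, rule suminf_minus_initial_segment[OF summable_abs_gtilde[OF \<alpha>]])
    thus ?thesis
      using tendsto_diff[OF tendsto_const[of "\<Sum>s. \<bar>gtilde \<alpha> s\<bar>"] summable_LIMSEQ[OF summable_abs_gtilde[OF \<alpha>]]]
      by simp
  qed
  hence lim: "(\<lambda>K. - ((t + 1) * tail K * B)) \<longlonglongrightarrow> - ((t + 1) * 0 * B)"
    by (rule tendsto_minus[OF tendsto_mult[OF tendsto_mult[OF tendsto_const] tendsto_const]])
  have "t * Re Z + \<sigma> * Im Z \<ge> 0" if \<sigma>: "\<bar>\<sigma>\<bar> = 1" for \<sigma> :: real
  proof -
    have "\<exists>N. \<forall>K\<ge>N. - ((t + 1) * tail K * B) \<le> t * Re Z + \<sigma> * Im Z"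
      using main[OF \<sigma>] by (intro exI[of _ "Suc m"]) auto
    from LIMSEQ_le_const2[OF lim this] show ?thesis by simp
  qed
  from this[of 1] this[of "-1"] show ?thesis by (simp add: t_def)
qed

text \<open>For the complex vector x + i y the real part of the Hermitian form is the sum of the two
  quadratic forms, and the imaginary part is the skew expression.\<close>

lemma Ltilde_sector:
  assumes \<alpha>: "1 < \<alpha>" "\<alpha> < 2"
  shows "\<bar>form m (Ltilde \<alpha> m) x y - form m (Ltilde \<alpha> m) y x\<bar>
    \<le> \<bar>tan (\<alpha> / 2 * pi)\<bar> * (form m (Ltilde \<alpha> m) x x + form m (Ltilde \<alpha> m) y y)"
proof -
  define Z where "Z = (\<Sum>l<m. \<Sum>k<m. cnj (Complex (x l) (y l)) * of_real (Ltilde \<alpha> m $$ (l, k))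
    * Complex (x k) (y k))"
  have entry:
    "Re (cnj (Complex a b) * of_real c * Complex a' b') = a * c * a' + b * c * b'"
    "Im (cnj (Complex a b) * of_real c * Complex a' b') = a * c * b' - b * c * a'" for a b c a' b'
    by (simp_all add: algebra_simps)
  have "Re Z = form m (Ltilde \<alpha> m) x x + form m (Ltilde \<alpha> m) y y"
    by (simp only: Z_def form_def Re_sum entry sum.distrib)
  moreover have "Im Z = form m (Ltilde \<alpha> m) x y - form m (Ltilde \<alpha> m) y x"
    by (simp only: Z_def form_def Im_sum entry sum_subtractf)
  moreover have "\<bar>Im Z\<bar> \<le> \<bar>tan (\<alpha> / 2 * pi)\<bar> * Re Z"
    unfolding Z_def by (rule Ltilde_numerical_range[OF \<alpha>])
  ultimately show ?thesis by simp
qed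

subsection \<open>Comparison with the tau matrix\<close>

text \<open>Each off-diagonal product is estimated by |x_j x_k| \<le> (x_j^2 + x_k^2)/2. Symmetry
  moves both halves onto x_j^2, where the diagonal entry of row j absorbs them.\<close>

lemma form_diagonally_dominant_nonneg:
  assumes sym: "\<And>j k. j < N \<Longrightarrow> k < N \<Longrightarrow> A $$ (j, k) = A $$ (k, j)"
    and dom: "\<And>j. j < N \<Longrightarrow> (\<Sum>k\<in>{..<N} - {j}. \<bar>A $$ (j, k)\<bar>) \<le> A $$ (j, j)"
  shows "form N A x x \<ge> 0"
proof -
  define a where "a = (\<lambda>j k. if k = j then 0 else \<bar>A $$ (j, k)\<bar>)"
  define D where "D = (\<lambda>j k. if k = j then A $$ (j, j) * (x j)\<^sup>2 else 0)"
  have sa: "a j k = a k j" if "j < N" "k < N" for j k using sym that by (simp add: a_def)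
  have swap: "(\<Sum>j<N. \<Sum>k<N. a j k * (x k)\<^sup>2) = (\<Sum>j<N. \<Sum>k<N. a j k * (x j)\<^sup>2)"
    by (subst sum.swap) (auto intro!: sum.cong simp: sa)
  have summand: "D j k - a j k * ((x j)\<^sup>2 + (x k)\<^sup>2) / 2 \<le> x j * A $$ (j, k) * x k" for j k
  proof (cases "k = j")
    case True
    thus ?thesis by (simp add: D_def a_def power2_eq_square)
  next
    case False
    have "\<bar>x j * x k\<bar> \<le> ((x j)\<^sup>2 + (x k)\<^sup>2) / 2"
      using sum_squares_bound[of "\<bar>x j\<bar>" "\<bar>x k\<bar>"] by (simp add: abs_mult)
    hence "\<bar>A $$ (j, k)\<bar> * \<bar>x j * x k\<bar> \<le> \<bar>A $$ (j, k)\<bar> * (((x j)\<^sup>2 + (x k)\<^sup>2) / 2)"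
      by (rule mult_left_mono) simp
    moreover have "\<bar>x j * A $$ (j, k) * x k\<bar> = \<bar>A $$ (j, k)\<bar> * \<bar>x j * x k\<bar>"
      by (simp add: abs_mult)
    ultimately show ?thesis using False by (simp add: D_def a_def)
  qed
  have "0 \<le> (\<Sum>j<N. (A $$ (j, j) - (\<Sum>k<N. a j k)) * (x j)\<^sup>2)"
  proof (intro sum_nonneg mult_nonneg_nonneg)
    fix j assume j: "j \<in> {..<N}"
    have "(\<Sum>k<N. a j k) = (\<Sum>k\<in>{..<N} - {j}. \<bar>A $$ (j, k)\<bar>)"
      using j by (simp add: a_def sum.If_cases Int_def set_diff_eq)
    thus "0 \<le> A $$ (j, j) - (\<Sum>k<N. a j k)" using dom j by simp
  qed simp
  also have "\<dots> = (\<Sum>j<N. \<Sum>k<N. D j k) - (\<Sum>j<N. \<Sum>k<N. a j k * (x j)\<^sup>2)"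
    by (simp add: D_def left_diff_distrib sum_subtractf sum_distrib_right)
  also have "\<dots> = (\<Sum>j<N. \<Sum>k<N. D j k - a j k * ((x j)\<^sup>2 + (x k)\<^sup>2) / 2)"
    using swap by (simp add: sum_subtractf distrib_left add_divide_distrib sum.distrib
        flip: sum_divide_distrib)
  also have "\<dots> \<le> form N A x x"
    unfolding form_def by (intro sum_mono summand)
  finally show ?thesis .
qed

text \<open>Signs are dropped here: \<^const>\<open>tau_mat\<close> subtracts a Hankel matrix with nonpositive entries,
  and \<open>offdiag\<close> and \<open>hankel_entry\<close> are the absolute values of the entries of the Toeplitz and
  of the Hankel part.\<close>

definition offdiag :: "real \<Rightarrow> nat \<Rightarrow> real" where
  "offdiag \<alpha> l = (if l = 1 then (1 + gtilde \<alpha> 2) / 2 else gtilde \<alpha> (l + 1) / 2)"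

definition hankel_entry :: "real \<Rightarrow> nat \<Rightarrow> nat \<Rightarrow> nat \<Rightarrow> real" where
  "hankel_entry \<alpha> m j k = (if j + k + 2 < m then offdiag \<alpha> (j + k + 2)
     else if m < j + k then offdiag \<alpha> (2 * m - j - k) else 0)"

lemma offdiag_nonneg: "\<lbrakk>1 < \<alpha>; \<alpha> < 2; l \<ge> 1\<rbrakk> \<Longrightarrow> offdiag \<alpha> l \<ge> 0"
  using gtilde_pos[of \<alpha> 0] gtilde_pos[of \<alpha> "l - 1"] by (auto simp: offdiag_def numeral_2_eq_2)

lemma offdiag_decreasing:
  assumes "1 < \<alpha>" "\<alpha> < 2" "1 \<le> k" "k \<le> l"
  shows "offdiag \<alpha> l \<le> offdiag \<alpha> k"
  using gtilde_decreasing[OF assms(1,2), of 2 "l + 1"] assms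
    gtilde_decreasing[OF assms(1,2), of "k + 1" "l + 1"] by (auto simp: offdiag_def)

text \<open>The doubled sum is \<open>gtilde\<close> summed up to m with index 1 left out. That
  coefficient is -\<alpha>, and the complete partial sum is nonpositive.\<close>

lemma offdiag_sum_le:
  assumes "1 < \<alpha>" "\<alpha> < 2"
  shows "2 * (\<Sum>l\<in>{1..<m}. offdiag \<alpha> l) \<le> \<alpha>"
proof (cases "m \<ge> 2")
  case False
  thus ?thesis using assms by simp
next
  case True
  have "2 * (\<Sum>l\<in>{1..<m}. offdiag \<alpha> l) = \<alpha> + (\<Sum>k\<le>m. gtilde \<alpha> k)"
    using True
  proof (induction m rule: dec_induct)
    case base
    show ?case by (simp add: offdiag_def numeral_2_eq_2 gtilde_1)
  next
    case (step m)
    thus ?case by (simp add: offdiag_def)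
  qed
  thus ?thesis using gtilde_sum_nonpos[OF assms, of m] True by simp
qed

lemma sym_part_Ltilde_index:
  assumes "j < m" "k < m"
  shows "sym_part (Ltilde \<alpha> m) $$ (j, k) =
    (if j = k then \<alpha> else - offdiag \<alpha> (if j < k then k - j else j - k))"
proof -
  have "j + 1 - k = Suc (j - k)" "k \<noteq> j \<Longrightarrow> k \<le> Suc j \<Longrightarrow> k = Suc j \<or> k < j" if "k \<le> j" for j k :: nat
    using that by auto
  thus ?thesis using assms
    by (auto simp: sym_part_def Ltilde_def offdiag_def gtilde_1 numeral_2_eq_2 Suc_diff_le not_less
        le_Suc_eq add_divide_distrib)
qed

lemma tau_index:
  assumes "j < m" "k < m"
  shows "tau_mat (sym_part (Ltilde \<alpha> m)) $$ (j, k)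
    = sym_part (Ltilde \<alpha> m) $$ (j, k) + hankel_entry \<alpha> m j k"
proof -
  have dim: "dim_row (sym_part (Ltilde \<alpha> m)) = m" "dim_col (sym_part (Ltilde \<alpha> m)) = m"
    by (simp_all add: sym_part_def Ltilde_def)
  show ?thesis using assms
    by (auto simp: tau_mat_def Let_def dim hankel_def hankel_entry_def sym_part_Ltilde_index mult_2)
qed

lemma hankel_entry_nonneg: "\<lbrakk>1 < \<alpha>; \<alpha> < 2; j < m; k < m\<rbrakk> \<Longrightarrow> hankel_entry \<alpha> m j k \<ge> 0"
  by (auto simp: hankel_entry_def intro!: offdiag_nonneg)

text \<open>The Hankel indices j + k + 2 and 2 m - j - k are both at least |j - k|, so monotonicity
  of \<open>offdiag\<close> applies.\<close>

lemma hankel_entry_le: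
  assumes "1 < \<alpha>" "\<alpha> < 2" "j < m" "k < m" "j \<noteq> k"
  shows "hankel_entry \<alpha> m j k \<le> offdiag \<alpha> (if j < k then k - j else j - k)"
  using assms by (auto simp: hankel_entry_def intro!: offdiag_decreasing offdiag_nonneg)

text \<open>The Toeplitz entries left of the diagonal have indices 1..j, and the upper Hankel part
  continues them with j + 2..m - 1. Right of the diagonal, 1..m - j - 1 is continued by m - j + 1..m
  - 1. Each chain uses every index below m at most once, so each costs at most \<alpha>/2.\<close>

lemma toeplitz_hankel_row_sum:
  assumes \<alpha>: "1 < \<alpha>" "\<alpha> < 2" and j: "j < m"
  shows "(\<Sum>k\<in>{..<m} - {j}. offdiag \<alpha> (if j < k then k - j else j - k))
    + (\<Sum>k<m. hankel_entry \<alpha> m j k) \<le> \<alpha>"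
proof -
  let ?p = "offdiag \<alpha>"
  define S where "S = (\<Sum>l\<in>{1..<m}. ?p l)"
  have split: "{..<m} - {j} = {..<j} \<union> {j<..<m}" using j by auto
  have "(\<Sum>k\<in>{..<m} - {j}. ?p (if j < k then k - j else j - k))
      = (\<Sum>k<j. ?p (if j < k then k - j else j - k))
        + (\<Sum>k\<in>{j<..<m}. ?p (if j < k then k - j else j - k))"
    unfolding split by (rule sum.union_disjoint) auto
  also have "\<dots> = (\<Sum>k<j. ?p (j - k)) + (\<Sum>k\<in>{j<..<m}. ?p (k - j))"
    by simp
  also have "(\<Sum>k<j. ?p (j - k)) = (\<Sum>l\<in>{1..j}. ?p l)"
    by (rule sum.reindex_bij_witness[of _ "\<lambda>l. j - l" "\<lambda>k. j - k"]) auto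
  also have "(\<Sum>k\<in>{j<..<m}. ?p (k - j)) = (\<Sum>l\<in>{1..<m - j}. ?p l)"
    by (rule sum.reindex_bij_witness[of _ "\<lambda>l. l + j" "\<lambda>k. k - j"]) auto
  finally have 1: "(\<Sum>k\<in>{..<m} - {j}. ?p (if j < k then k - j else j - k))
      = (\<Sum>l\<in>{1..j}. ?p l) + (\<Sum>l\<in>{1..<m - j}. ?p l)" .
  have "(\<Sum>k<m. hankel_entry \<alpha> m j k)
      = (\<Sum>k<m. (if j + k + 2 < m then ?p (j + k + 2) else 0))
        + (\<Sum>k<m. (if m < j + k then ?p (2 * m - j - k) else 0))"
    unfolding sum.distrib[symmetric] by (intro sum.cong) (auto simp: hankel_entry_def)
  also have "(\<Sum>k<m. (if j + k + 2 < m then ?p (j + k + 2) else 0))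
      = (\<Sum>k | k < m \<and> j + k + 2 < m. ?p (j + k + 2))"
    by (simp add: sum.If_cases Int_def)
  also have "\<dots> = (\<Sum>l\<in>{j + 2..<m}. ?p l)"
    by (rule sum.reindex_bij_witness[of _ "\<lambda>l. l - (j + 2)" "\<lambda>k. j + k + 2"]) auto
  also have "(\<Sum>k<m. (if m < j + k then ?p (2 * m - j - k) else 0))
      = (\<Sum>k | k < m \<and> m < j + k. ?p (2 * m - j - k))"
    by (simp add: sum.If_cases Int_def)
  also have "\<dots> = (\<Sum>l\<in>{m - j<..<m}. ?p l)"
    using j by (intro sum.reindex_bij_witness[of _ "\<lambda>l. 2 * m - j - l" "\<lambda>k. 2 * m - j - k"]) auto
  finally have 2: "(\<Sum>k<m. hankel_entry \<alpha> m j k)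
      = (\<Sum>l\<in>{j + 2..<m}. ?p l) + (\<Sum>l\<in>{m - j<..<m}. ?p l)" .
  have "(\<Sum>l\<in>{1..j}. ?p l) + (\<Sum>l\<in>{j + 2..<m}. ?p l) = (\<Sum>l\<in>{1..j} \<union> {j + 2..<m}. ?p l)"
    by (rule sum.union_disjoint[symmetric]) auto
  also have "\<dots> \<le> S"
    unfolding S_def using j by (intro sum_mono2) (auto intro!: offdiag_nonneg \<alpha>)
  finally have 3: "(\<Sum>l\<in>{1..j}. ?p l) + (\<Sum>l\<in>{j + 2..<m}. ?p l) \<le> S" .
  have "(\<Sum>l\<in>{1..<m - j}. ?p l) + (\<Sum>l\<in>{m - j<..<m}. ?p l)
      = (\<Sum>l\<in>{1..<m - j} \<union> {m - j<..<m}. ?p l)"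
    by (rule sum.union_disjoint[symmetric]) auto
  also have "\<dots> \<le> S"
    unfolding S_def using j by (intro sum_mono2) (auto intro!: offdiag_nonneg \<alpha>)
  finally have 4: "(\<Sum>l\<in>{1..<m - j}. ?p l) + (\<Sum>l\<in>{m - j<..<m}. ?p l) \<le> S" .
  have "2 * S \<le> \<alpha>" unfolding S_def by (rule offdiag_sum_le[OF \<alpha>])
  thus ?thesis using 1 2 3 4 by linarith
qed

lemma Ltilde_form_vs_tau:
  assumes \<alpha>: "1 < \<alpha>" "\<alpha> < 2"
  shows "form m (tau_mat (sym_part (Ltilde \<alpha> m))) x x \<le> 2 * form m (Ltilde \<alpha> m) x x"
    and "2 * form m (Ltilde \<alpha> m) x x \<le> 3 * form m (tau_mat (sym_part (Ltilde \<alpha> m))) x x"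
proof -
  let ?T = "sym_part (Ltilde \<alpha> m)" and ?\<tau> = "tau_mat (sym_part (Ltilde \<alpha> m))"
  let ?q = "hankel_entry \<alpha> m"
  have qsym: "?q j k = ?q k j" for j k
    by (simp add: hankel_entry_def add.commute diff_commute)
  have Tsym: "?T $$ (j, k) = ?T $$ (k, j)" if "j < m" "k < m" for j k
    using that by (auto simp: sym_part_Ltilde_index)
  \<comment> \<open>Off the diagonal the entries are -p + c q with 0 \<le> q \<le> p. For c = -1 the
    absolute value equals p + q; for c = 3 it is at most p + q exactly because q \<le> p. On the
    diagonal, \<alpha> + c q is at least \<alpha> - q.\<close>
  have psd: "form m (Matrix.mat m m (\<lambda>(j, k). ?T $$ (j, k) + c * ?q j k)) x x \<ge> 0"
    if c: "c = -1 \<or> c = 3" for c :: real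
  proof (rule form_diagonally_dominant_nonneg)
    fix j assume j: "j < m"
    let ?p = "\<lambda>k. offdiag \<alpha> (if j < k then k - j else j - k)"
    have "(\<Sum>k\<in>{..<m} - {j}. \<bar>Matrix.mat m m (\<lambda>(j, k). ?T $$ (j, k) + c * ?q j k) $$ (j, k)\<bar>)
        \<le> (\<Sum>k\<in>{..<m} - {j}. ?p k + ?q j k)"
    proof (rule sum_mono)
      fix k assume k: "k \<in> {..<m} - {j}"
      show "\<bar>Matrix.mat m m (\<lambda>(j, k). ?T $$ (j, k) + c * ?q j k) $$ (j, k)\<bar> \<le> ?p k + ?q j k"
        using c j k hankel_entry_le[OF \<alpha> j, of k] hankel_entry_nonneg[OF \<alpha> j, of k]
        by (auto simp: sym_part_Ltilde_index)
    qed
    also have "\<dots> = (\<Sum>k\<in>{..<m} - {j}. ?p k) + ((\<Sum>k<m. ?q j k) - ?q j j)"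
      using j by (simp add: sum.distrib sum_diff1)
    also have "\<dots> \<le> \<alpha> - ?q j j" using toeplitz_hankel_row_sum[OF \<alpha> j] by simp
    also have "\<dots> \<le> Matrix.mat m m (\<lambda>(j, k). ?T $$ (j, k) + c * ?q j k) $$ (j, j)"
      using c j hankel_entry_nonneg[OF \<alpha> j j] by (auto simp: sym_part_Ltilde_index)
    finally show "(\<Sum>k\<in>{..<m} - {j}. \<bar>Matrix.mat m m (\<lambda>(j, k). ?T $$ (j, k) + c * ?q j k) $$ (j, k)\<bar>)
        \<le> Matrix.mat m m (\<lambda>(j, k). ?T $$ (j, k) + c * ?q j k) $$ (j, j)" .
  qed (use qsym Tsym in auto)
  \<comment> \<open>Here q is the difference between the tau matrix and T, so c = -1 gives \<tau>(T)
    \<le> 2 T and c = 3 gives 2 T \<le> 3 \<tau>(T).\<close>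
  have lin: "form m (Matrix.mat m m (\<lambda>(j, k). ?T $$ (j, k) + c * ?q j k)) x x
      = form m ?T x x + c * (form m ?\<tau> x x - form m ?T x x)" for c
    by (simp add: form_def tau_index algebra_simps sum_distrib_left flip: sum.distrib sum_subtractf)
  have "(\<Sum>j<m. \<Sum>k<m. x j * (Ltilde \<alpha> m $$ (k, j) * x k))
      = (\<Sum>j<m. \<Sum>k<m. x j * (Ltilde \<alpha> m $$ (j, k) * x k))"
    by (subst sum.swap) (simp add: mult.left_commute mult.commute)
  hence T: "form m ?T x x = form m (Ltilde \<alpha> m) x x"
    by (simp add: form_def sym_part_def Ltilde_def[of \<alpha> m] algebra_simps sum.distrib
        add_divide_distrib flip: sum_divide_distrib)
  from psd[of "-1"] psd[of 3] show "form m ?\<tau> x x \<le> 2 * form m (Ltilde \<alpha> m) x x"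
    "2 * form m (Ltilde \<alpha> m) x x \<le> 3 * form m ?\<tau> x x"
    unfolding lin T by simp_all
qed

subsection \<open>Kronecker products and reversal symmetry\<close>

lemma sum_lessThan_mult:
  fixes f :: "nat \<Rightarrow> 'a :: comm_monoid_add"
  shows "(\<Sum>r<a * b. f r) = (\<Sum>i<a. \<Sum>j<b. f (i * b + j))"
proof -
  have "sum f {i * b..<i * b + b} = (\<Sum>j<b. f (i * b + j))" for i
    by (rule sum.reindex_bij_witness[of _ "\<lambda>j. i * b + j" "\<lambda>r. r - i * b"]) auto
  thus ?thesis by (simp flip: sum.nat_group)
qed

lemma mult_add_less_mult: "i < a \<Longrightarrow> j < b \<Longrightarrow> i * b + j < a * (b :: nat)"
proof -
  assume "i < a" "j < b"
  hence "i * b + j < Suc i * b" by simp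
  also have "Suc i * b \<le> a * b" using \<open>i < a\<close> by (intro mult_le_mono1) simp
  finally show ?thesis .
qed

lemma form_kron:
  assumes "A \<in> carrier_mat a a" "B \<in> carrier_mat b b"
  shows "form (a * b) (A \<otimes>\<^sub>K B) x y = (\<Sum>i<a. \<Sum>j<b. \<Sum>i'<a. \<Sum>j'<b.
    x (i * b + j) * (A $$ (i, i') * B $$ (j, j')) * y (i' * b + j'))"
  using assms by (simp add: form_def sum_lessThan_mult kron_def mult_add_less_mult)

lemma form_one_kron:
  assumes "B \<in> carrier_mat b b"
  shows "form (a * b) (1\<^sub>m a \<otimes>\<^sub>K B) x y
    = (\<Sum>i<a. form b B (\<lambda>j. x (i * b + j)) (\<lambda>j. y (i * b + j)))"
  unfolding form_kron[OF one_carrier_mat assms] unfolding form_def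
proof (rule sum.cong[OF refl], rule sum.cong[OF refl])
  fix i j assume "i \<in> {..<a}"
  have "(\<Sum>i'<a. \<Sum>j'<b. x (i * b + j) * (1\<^sub>m a $$ (i, i') * B $$ (j, j')) * y (i' * b + j'))
    = (\<Sum>i'<a. if i = i' then \<Sum>j'<b. x (i * b + j) * B $$ (j, j') * y (i' * b + j') else 0)"
    using \<open>i \<in> {..<a}\<close> by (intro sum.cong) auto
  thus "(\<Sum>i'<a. \<Sum>j'<b. x (i * b + j) * (1\<^sub>m a $$ (i, i') * B $$ (j, j')) * y (i' * b + j'))
    = (\<Sum>k<b. x (i * b + j) * B $$ (j, k) * y (i * b + k))"
    using \<open>i \<in> {..<a}\<close> by simp
qed

lemma form_kron_one:
  assumes "A \<in> carrier_mat a a"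
  shows "form (a * b) (A \<otimes>\<^sub>K 1\<^sub>m b) x y
    = (\<Sum>q<b. form a A (\<lambda>j. x (j * b + q)) (\<lambda>j. y (j * b + q)))"
proof -
  have "form (a * b) (A \<otimes>\<^sub>K 1\<^sub>m b) x y = (\<Sum>i<a. \<Sum>q<b. \<Sum>i'<a. x (i * b + q) * A $$ (i, i') * y (i' * b + q))"
    unfolding form_kron[OF assms one_carrier_mat]
  proof (intro sum.cong refl)
    fix i q i' assume "q \<in> {..<b}"
    have "(\<Sum>j'<b. x (i * b + q) * (A $$ (i, i') * 1\<^sub>m b $$ (q, j')) * y (i' * b + j'))
      = (\<Sum>j'<b. if q = j' then x (i * b + q) * A $$ (i, i') * y (i' * b + j') else 0)"
      using \<open>q \<in> {..<b}\<close> by (intro sum.cong) auto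
    thus "(\<Sum>j'<b. x (i * b + q) * (A $$ (i, i') * 1\<^sub>m b $$ (q, j')) * y (i' * b + j'))
      = x (i * b + q) * A $$ (i, i') * y (i' * b + q)"
      using \<open>q \<in> {..<b}\<close> by simp
  qed
  also have "\<dots> = (\<Sum>q<b. form a A (\<lambda>j. x (j * b + q)) (\<lambda>j. y (j * b + q)))"
    unfolding form_def by (rule sum.swap)
  finally show ?thesis .
qed

lemma kron_carrier: "\<lbrakk>A \<in> carrier_mat a a; B \<in> carrier_mat b b\<rbrakk> \<Longrightarrow> A \<otimes>\<^sub>K B \<in> carrier_mat (a * b) (a * b)"
  by (auto simp: kron_def)

lemma total_dim_split:
  assumes "i \<in> {1..d}"
  shows "total_dim d n = (\<Prod>j\<in>{1..<i}. n j) * (n i * (\<Prod>j\<in>{i<..d}. n j))"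
proof -
  have split: "{1..d} = {1..<i} \<union> insert i {i<..d}" using assms by auto
  have "total_dim d n = (\<Prod>j\<in>{1..<i}. n j) * (\<Prod>j\<in>insert i {i<..d}. n j)"
    unfolding total_dim_def split by (rule prod.union_disjoint) auto
  thus ?thesis by simp
qed

lemma lift_dir_carrier:
  assumes "i \<in> {1..d}" "X \<in> carrier_mat (n i) (n i)"
  shows "lift_dir d n i X \<in> carrier_mat (total_dim d n) (total_dim d n)"
  unfolding lift_dir_def total_dim_split[OF assms(1)] by (intro kron_carrier assms one_carrier_mat)

text \<open>In lexicographic numbering this is x on one grid line in direction i: p encodes the
  coordinates before i, q those after it.\<close>

definition slice :: "nat \<Rightarrow> (nat \<Rightarrow> nat) \<Rightarrow> nat \<Rightarrow> nat \<Rightarrow> nat \<Rightarrow> (nat \<Rightarrow> real) \<Rightarrow> nat \<Rightarrow> real" where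
  "slice d n i p q x = (\<lambda>j. x (p * (n i * (\<Prod>j\<in>{i<..d}. n j)) + (j * (\<Prod>j\<in>{i<..d}. n j) + q)))"

lemma form_lift_dir:
  assumes "i \<in> {1..d}" "X \<in> carrier_mat (n i) (n i)"
  shows "form (total_dim d n) (lift_dir d n i X) x y
    = (\<Sum>p<(\<Prod>j\<in>{1..<i}. n j). \<Sum>q<(\<Prod>j\<in>{i<..d}. n j). form (n i) X (slice d n i p q x) (slice d n i p q y))"
  unfolding lift_dir_def total_dim_split[OF assms(1)] slice_def
  by (subst form_one_kron[OF kron_carrier[OF assms(2) one_carrier_mat]])
    (simp add: form_kron_one[OF assms(2)])

text \<open>Entrywise form of Y A Y = A^T. Equivalently Y A is symmetric; if A is symmetric as well,
  it commutes with Y.\<close>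

definition persymmetric :: "nat \<Rightarrow> 'a mat \<Rightarrow> bool" where
  "persymmetric N A \<longleftrightarrow> (\<forall>r<N. \<forall>c<N. A $$ (N - Suc r, N - Suc c) = A $$ (c, r))"

definition symmetric :: "nat \<Rightarrow> 'a mat \<Rightarrow> bool" where
  "symmetric N A \<longleftrightarrow> (\<forall>r<N. \<forall>c<N. A $$ (r, c) = A $$ (c, r))"

section \<open>Index reversal and symmetry of Kronecker products\<close>

lemma kron_index:
  assumes "A \<in> carrier_mat a a" "B \<in> carrier_mat b b" "r < a * b" "c < a * b"
  shows "(A \<otimes>\<^sub>K B) $$ (r, c) = A $$ (r div b, c div b) * B $$ (r mod b, c mod b)"
  using assms by (simp add: kron_def)

lemma div_mod_less:
  assumes "r < a * (b :: nat)"
  shows "r div b < a" "r mod b < b"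
  using assms by (auto simp: less_mult_imp_div_less) (metis mod_less_divisor mult_0_right not_gr_zero not_less_zero)

text \<open>Subtracting r from a * b - 1 needs no borrow: the two mixed-radix digits of r are
  complemented separately. Hence index reversal respects Kronecker products.\<close>

lemma reverse_div_mod:
  assumes "r < a * (b :: nat)"
  shows "(a * b - Suc r) div b = a - Suc (r div b)" "(a * b - Suc r) mod b = b - Suc (r mod b)"
proof -
  define i j where ij: "i = r div b" "j = r mod b"
  have lt: "i < a" "j < b" using div_mod_less[OF assms] by (simp_all add: ij)
  have r: "r = i * b + j" by (simp add: ij)
  obtain i' j' where i': "a = i + Suc i'" and j': "b = j + Suc j'"
    using lt by (metis less_imp_Suc_add add_Suc_right)
  have eq: "a * b - Suc r = i' * b + j'"
    unfolding r i' by (simp add: add_mult_distrib) (simp add: j')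
  have j'b: "j' < b" by (simp add: j')
  have "a - Suc i = i'" "b - Suc j = j'" by (simp add: i', subst j', simp)
  thus "(a * b - Suc r) div b = a - Suc (r div b)" "(a * b - Suc r) mod b = b - Suc (r mod b)"
    unfolding eq ij[symmetric] using j'b by simp_all
qed

lemma persymmetric_kron:
  assumes "A \<in> carrier_mat a a" "B \<in> carrier_mat b b" "persymmetric a A" "persymmetric b B"
  shows "persymmetric (a * b) (A \<otimes>\<^sub>K B)"
  unfolding persymmetric_def
proof (intro allI impI)
  fix r c assume rc: "r < a * b" "c < a * b"
  show "(A \<otimes>\<^sub>K B) $$ (a * b - Suc r, a * b - Suc c) = (A \<otimes>\<^sub>K B) $$ (c, r)"
    using rc assms(3,4) div_mod_less[OF rc(1)] div_mod_less[OF rc(2)]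
    by (simp add: kron_index[OF assms(1,2)] reverse_div_mod persymmetric_def)
qed

lemma symmetric_kron:
  assumes "A \<in> carrier_mat a a" "B \<in> carrier_mat b b" "symmetric a A" "symmetric b B"
  shows "symmetric (a * b) (A \<otimes>\<^sub>K B)"
  unfolding symmetric_def
proof (intro allI impI)
  fix r c assume rc: "r < a * b" "c < a * b"
  show "(A \<otimes>\<^sub>K B) $$ (r, c) = (A \<otimes>\<^sub>K B) $$ (c, r)"
    unfolding kron_index[OF assms(1,2) rc] kron_index[OF assms(1,2) rc(2,1)]
    using assms(3,4) div_mod_less[OF rc(1)] div_mod_less[OF rc(2)]
    by (metis symmetric_def)
qed

lemma persymmetric_one: "persymmetric a (1\<^sub>m a)"
  by (auto simp: persymmetric_def)

lemma symmetric_one: "symmetric a (1\<^sub>m a)"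
  by (auto simp: symmetric_def)

lemma persymmetric_lift_dir:
  assumes "i \<in> {1..d}" "X \<in> carrier_mat (n i) (n i)" "persymmetric (n i) X"
  shows "persymmetric (total_dim d n) (lift_dir d n i X)"
  unfolding lift_dir_def total_dim_split[OF assms(1)]
  by (intro persymmetric_kron kron_carrier assms one_carrier_mat persymmetric_one)

lemma symmetric_lift_dir:
  assumes "i \<in> {1..d}" "X \<in> carrier_mat (n i) (n i)" "symmetric (n i) X"
  shows "symmetric (total_dim d n) (lift_dir d n i X)"
  unfolding lift_dir_def total_dim_split[OF assms(1)]
  by (intro symmetric_kron kron_carrier assms one_carrier_mat symmetric_one)

lemma kron_anti_id: "anti_id a \<otimes>\<^sub>K anti_id b = (anti_id (a * b) :: real mat)"
proof (rule eq_matI)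
  show "dim_row (anti_id a \<otimes>\<^sub>K anti_id b :: real mat) = dim_row (anti_id (a * b) :: real mat)"
    "dim_col (anti_id a \<otimes>\<^sub>K anti_id b :: real mat) = dim_col (anti_id (a * b) :: real mat)"
    by (simp_all add: kron_def anti_id_def)
  fix r c assume "r < dim_row (anti_id (a * b) :: real mat)" "c < dim_col (anti_id (a * b) :: real mat)"
  hence rc: "r < a * b" "c < a * b" by (simp_all add: anti_id_def)
  have "r + c + 1 = a * b \<longleftrightarrow> c = a * b - Suc r" using rc by auto
  also have "\<dots> \<longleftrightarrow> c div b = (a * b - Suc r) div b \<and> c mod b = (a * b - Suc r) mod b"
    by (metis div_mult_mod_eq)
  also have "\<dots> \<longleftrightarrow> r div b + c div b + 1 = a \<and> r mod b + c mod b + 1 = b"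
    using div_mod_less[OF rc(1)] by (auto simp: reverse_div_mod[OF rc(1)])
  finally show "(anti_id a \<otimes>\<^sub>K anti_id b) $$ (r, c) = (anti_id (a * b) :: real mat) $$ (r, c)"
    using rc div_mod_less[OF rc(1)] div_mod_less[OF rc(2)]
    by (simp add: kron_def anti_id_def)
qed

lemma Y_mat_eq: "Y_mat d n = anti_id (total_dim d n)"
  unfolding Y_mat_def total_dim_def
proof (induction d)
  case 0
  show ?case by (rule eq_matI) (auto simp: anti_id_def)
next
  case (Suc d)
  thus ?case by (simp add: kron_anti_id)
qed

section \<open>Symmetries of the one-dimensional blocks\<close>

lemma Ltilde_carrier: "Ltilde \<alpha> m \<in> carrier_mat m m"
  by (simp add: Ltilde_def)

lemma tau_carrier: "tau_mat (sym_part (Ltilde \<alpha> m)) \<in> carrier_mat m m"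
  by (simp add: tau_mat_def Let_def hankel_def sym_part_def Ltilde_def minus_mat_def carrier_matI)

lemma persymmetric_Ltilde: "persymmetric m (Ltilde \<alpha> m)"
proof -
  have "m - Suc c \<le> m - Suc r + 1 \<longleftrightarrow> r \<le> c + 1"
    "m - Suc c \<le> m - Suc r + 1 \<Longrightarrow> m - Suc r + 1 - (m - Suc c) = c + 1 - r" if "r < m" "c < m" for r c
    using that by auto
  thus ?thesis by (simp add: persymmetric_def Ltilde_def)
qed

lemma symmetric_tau: "symmetric m (tau_mat (sym_part (Ltilde \<alpha> m)))"
  by (auto simp: symmetric_def tau_index sym_part_Ltilde_index hankel_entry_def add.commute diff_commute)

lemma persymmetric_tau: "persymmetric m (tau_mat (sym_part (Ltilde \<alpha> m)))"
  unfolding persymmetric_def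
proof (intro allI impI)
  fix r c assume rc: "r < m" "c < m"
  have "hankel_entry \<alpha> m (m - Suc r) (m - Suc c) = hankel_entry \<alpha> m r c"
    using rc by (auto simp: hankel_entry_def intro!: arg_cong[of _ _ "offdiag \<alpha>"])
  moreover have "hankel_entry \<alpha> m r c = hankel_entry \<alpha> m c r"
    by (simp add: hankel_entry_def add.commute diff_commute)
  moreover have "sym_part (Ltilde \<alpha> m) $$ (m - Suc r, m - Suc c) = sym_part (Ltilde \<alpha> m) $$ (c, r)"
    using rc by (auto simp: sym_part_Ltilde_index intro!: arg_cong[of _ _ "offdiag \<alpha>"])
  ultimately show "tau_mat (sym_part (Ltilde \<alpha> m)) $$ (m - Suc r, m - Suc c)
      = tau_mat (sym_part (Ltilde \<alpha> m)) $$ (c, r)"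
    using rc by (simp add: tau_index)
qed

subsection \<open>Eigenvalues of reversed pencils\<close>

definition reversal :: "nat \<Rightarrow> (nat \<Rightarrow> real) \<Rightarrow> nat \<Rightarrow> real" where
  "reversal N x = (\<lambda>r. x (N - Suc r))"

lemma form_reversal_left: "form N A (reversal N x) y = (\<Sum>r<N. x r * (\<Sum>k<N. A $$ (N - Suc r, k) * y k))"
  unfolding form_def reversal_def
  by (subst sum.nat_diff_reindex[symmetric]) (auto intro!: sum.cong simp: sum_distrib_left mult.assoc)

lemma form_reversal_reversal:
  assumes "persymmetric N A"
  shows "form N A (reversal N x) (reversal N y) = form N A y x"
proof -
  have "form N A (reversal N x) (reversal N y)
      = (\<Sum>r<N. \<Sum>k<N. x r * A $$ (N - Suc r, N - Suc k) * y k)"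
    unfolding form_reversal_left unfolding reversal_def sum_distrib_left mult.assoc[symmetric]
    by (rule sum.cong[OF refl], subst sum.nat_diff_reindex[symmetric]) (auto intro!: sum.cong)
  also have "\<dots> = (\<Sum>r<N. \<Sum>k<N. x r * A $$ (k, r) * y k)"
    using assms by (intro sum.cong) (auto simp: persymmetric_def)
  also have "\<dots> = form N A y x"
    unfolding form_def by (subst sum.swap) (simp add: mult_ac)
  finally show ?thesis .
qed

lemma form_symmetric:
  assumes "symmetric N A"
  shows "form N A x y = form N A y x"
proof -
  have "form N A x y = (\<Sum>r<N. \<Sum>k<N. x r * A $$ (k, r) * y k)"
    unfolding form_def using assms by (intro sum.cong) (auto simp: symmetric_def)
  also have "\<dots> = form N A y x"
    unfolding form_def by (subst sum.swap) (simp add: mult_ac)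
  finally show ?thesis .
qed

lemma form_add:
  "form N A (\<lambda>r. x r + c * y r) (\<lambda>r. x r + c * y r)
    = form N A x x + c * (form N A x y + form N A y x) + c * c * form N A y y"
  unfolding form_def sum_distrib_left sum.distrib[symmetric]
  by (intro sum.cong refl) (simp add: algebra_simps)

text \<open>Both mixed terms are kept so that no symmetry of A is needed; the bound serves
  \<open>Wtilde\<close> as well as \<open>Ptilde\<close>.\<close>

lemma form_polarization_bound:
  assumes "\<And>x. form N A x x \<ge> 0"
  shows "\<bar>form N A x y + form N A y x\<bar> \<le> form N A x x + form N A y y"
  using assms[of "\<lambda>r. x r + 1 * y r"] assms[of "\<lambda>r. x r + (-1) * y r"]
  unfolding form_add by simp

lemma form_reversal_double: "form N A (reversal N (reversal N x)) y = form N A x y"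
  unfolding form_def reversal_def by (intro sum.cong) (auto simp: Suc_diff_Suc)

lemma reversed_pencil_eigenvalue:
  fixes v :: "nat \<Rightarrow> complex"
  assumes A: "persymmetric N A"
    and P: "persymmetric N P" "symmetric N P"
    and pos: "\<And>x. \<exists>r<N. x r \<noteq> 0 \<Longrightarrow> form N P x x > 0"
    and lower: "\<And>x. \<exists>r<N. x r \<noteq> 0 \<Longrightarrow> form N P x x < 2 * form N A x x"
    and upper: "\<And>x. \<exists>r<N. x r \<noteq> 0 \<Longrightarrow> \<bar>form N A (reversal N x) x\<bar> < C * form N P x x"
    and v: "\<exists>r<N. v r \<noteq> 0"
    and eig: "\<And>r. r < N \<Longrightarrow> (\<Sum>k<N. of_real (A $$ (N - Suc r, k)) * v k)
        = z * (\<Sum>k<N. of_real (P $$ (r, k)) * v k)"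
  shows "\<exists>s. z = of_real s \<and> 1/2 < \<bar>s\<bar> \<and> \<bar>s\<bar> < C"
proof -
  define x y where "x = (\<lambda>r. Re (v r))" and "y = (\<lambda>r. Im (v r))"
  define s t where "s = Re z" and "t = Im z"
  have re: "(\<Sum>k<N. A $$ (N - Suc r, k) * x k)
      = s * (\<Sum>k<N. P $$ (r, k) * x k) - t * (\<Sum>k<N. P $$ (r, k) * y k)" if "r < N" for r
    using arg_cong[OF eig[OF that], of Re] by (simp add: x_def y_def s_def t_def)
  have im: "(\<Sum>k<N. A $$ (N - Suc r, k) * y k)
      = s * (\<Sum>k<N. P $$ (r, k) * y k) + t * (\<Sum>k<N. P $$ (r, k) * x k)" if "r < N" for r
    using arg_cong[OF eig[OF that], of Im] by (simp add: x_def y_def s_def t_def)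
  have fp: "form N P \<phi> u = (\<Sum>r<N. \<phi> r * (\<Sum>k<N. P $$ (r, k) * u k))" for \<phi> u
    by (simp add: form_def sum_distrib_left mult.assoc)
  have fx: "form N A (reversal N \<phi>) x = s * form N P \<phi> x - t * form N P \<phi> y" for \<phi>
    unfolding form_reversal_left fp
    by (simp add: re sum_distrib_left right_diff_distrib sum_subtractf mult.left_commute)
  have fy: "form N A (reversal N \<phi>) y = s * form N P \<phi> y + t * form N P \<phi> x" for \<phi>
    unfolding form_reversal_left fp
    by (simp add: im sum_distrib_left distrib_left sum.distrib mult.left_commute)
  \<comment> \<open>This is the symmetry of Y A. Equating \<open>fx\<close> at \<phi> = y with
    \<open>fy\<close> at \<phi> = x cancels s and leaves t times a positive number.\<close>
  have "form N A (reversal N y) x = form N A (reversal N x) y"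
    by (metis form_reversal_double form_reversal_reversal[OF A])
  hence "t * (form N P x x + form N P y y) = 0"
    using form_symmetric[OF P(2), of x y] by (simp add: fx fy algebra_simps)
  moreover have nn: "form N P u u \<ge> 0" for u
  proof (cases "\<exists>r<N. u r \<noteq> 0")
    case False
    thus ?thesis by (simp add: form_def)
  qed (use pos in \<open>auto intro: less_imp_le\<close>)
  have ex: "(\<exists>r<N. x r \<noteq> 0) \<or> (\<exists>r<N. y r \<noteq> 0)"
    using v by (auto simp: x_def y_def complex_eq_iff)
  hence "form N P x x + form N P y y > 0"
    using pos[of x] pos[of y] nn[of x] nn[of y] by (elim disjE) (auto intro: add_pos_nonneg add_nonneg_pos)
  ultimately have t: "t = 0" by simp
  \<comment> \<open>With t = 0 the real and the imaginary part satisfy the equation separately; a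
    nonzero one of them serves as u.\<close>
  obtain u where u: "\<exists>r<N. u r \<noteq> 0"
    and fu: "\<And>\<phi>. form N A (reversal N \<phi>) u = s * form N P \<phi> u"
    using ex fx fy t by auto
  have pu: "form N P u u > 0" by (rule pos[OF u])
  \<comment> \<open>The test vector u gives the upper bound on |s|.\<close>
  have "\<bar>s\<bar> * form N P u u < C * form N P u u"
    using upper[OF u] pu by (simp add: fu abs_mult)
  hence 1: "\<bar>s\<bar> < C" using pu by simp
  \<comment> \<open>The test vector Yu undoes the flip and gives the lower bound: the left side is
    more than half of the form of P at u, and the mixed form of P is at most that form because P
    commutes with Y.\<close>
  have "form N A u u = s * form N P (reversal N u) u"
    using fu[of "reversal N u"] by (simp add: form_reversal_double)
  moreover have "\<bar>form N P (reversal N u) u\<bar> \<le> form N P u u"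
    using form_polarization_bound[OF nn, of "reversal N u" u] form_symmetric[OF P(2), of u "reversal N u"]
    by (simp add: form_reversal_reversal[OF P(1)])
  ultimately have "form N A u u \<le> \<bar>s\<bar> * form N P u u"
    by (metis abs_ge_self abs_ge_zero abs_mult mult_left_mono order_trans)
  hence "(1/2) * form N P u u < \<bar>s\<bar> * form N P u u" using lower[OF u] by simp
  hence "1/2 < \<bar>s\<bar>" using pu by (simp only: mult_less_cancel_right_pos)
  moreover have "z = of_real s" using t by (simp add: complex_eq_iff s_def t_def)
  ultimately show ?thesis using 1 by blast
qed

lemma positive_definite_inverse:
  assumes P: "P \<in> carrier_mat N N"
    and pos: "\<And>x. \<exists>r<N. x r \<noteq> 0 \<Longrightarrow> form N P x x > 0"
  shows "\<exists>Q \<in> carrier_mat N N. Q * P = 1\<^sub>m N \<and> P * Q = 1\<^sub>m N"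
proof -
  have "det P \<noteq> 0"
  proof
    assume "det P = 0"
    then obtain v where v: "v \<in> carrier_vec N" "v \<noteq> 0\<^sub>v N" "P *\<^sub>v v = 0\<^sub>v N"
      using det_0_iff_vec_prod_zero[OF P] by blast
    have "(\<Sum>k<N. P $$ (r, k) * vec_index v k) = 0" if "r < N" for r
    proof -
      have "vec_index (P *\<^sub>v v) r = 0" using v(3) that by simp
      thus ?thesis using that P v(1) by (simp add: scalar_prod_def atLeast0LessThan)
    qed
    hence "form N P (vec_index v) (vec_index v) = 0"
      by (simp add: form_def mult.assoc flip: sum_distrib_left)
    moreover have "\<exists>r<N. vec_index v r \<noteq> 0" using v by (auto simp: vec_eq_iff)
    ultimately show False using pos[of "vec_index v"] by simp
  qed
  from det_non_zero_imp_unit[OF P this, of "()"] show ?thesis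
    by (auto simp: Units_def ring_mat_simps)
qed

subsection \<open>The two matrices of the scheme\<close>

lemma Wtilde_carrier: "i \<in> {1..d} \<Longrightarrow> Wtilde d n \<alpha> i \<in> carrier_mat (total_dim d n) (total_dim d n)"
  unfolding Wtilde_def by (intro lift_dir_carrier Ltilde_carrier)

text \<open>Both sides are additive over grid lines, so the one-dimensional bound survives with the
  same constant.\<close>

lemma Wtilde_sector:
  fixes n :: "nat \<Rightarrow> nat"
  assumes i: "i \<in> {1..d}" and \<alpha>: "1 < \<alpha> i" "\<alpha> i < 2"
  defines "F \<equiv> form (total_dim d n) (Wtilde d n \<alpha> i)"
  shows "\<bar>F x y - F y x\<bar> \<le> \<bar>tan (\<alpha> i / 2 * pi)\<bar> * (F x x + F y y)"
  unfolding F_def Wtilde_def form_lift_dir[OF i Ltilde_carrier] sum_subtractf[symmetric]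
    sum.distrib[symmetric] sum_distrib_left
  by (intro order_trans[OF sum_abs] sum_mono Ltilde_sector \<alpha>)

lemma Wtilde_form_vs_tau:
  fixes n :: "nat \<Rightarrow> nat"
  assumes i: "i \<in> {1..d}" and \<alpha>: "1 < \<alpha> i" "\<alpha> i < 2"
  defines "F \<equiv> form (total_dim d n) (Wtilde d n \<alpha> i)"
    and "G \<equiv> form (total_dim d n) (lift_dir d n i (tau_mat (sym_part (Ltilde (\<alpha> i) (n i)))))"
  shows "G x x \<le> 2 * F x x" "2 * F x x \<le> 3 * G x x"
  unfolding F_def G_def Wtilde_def form_lift_dir[OF i Ltilde_carrier] form_lift_dir[OF i tau_carrier]
    sum_distrib_left
  by (intro sum_mono Ltilde_form_vs_tau \<alpha>)+

lemma form_shifted_mat_sum: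
  "form N (\<nu> \<cdot>\<^sub>m 1\<^sub>m N + mat_sum N B I) x y = \<nu> * (\<Sum>r<N. x r * y r) + (\<Sum>i\<in>I. form N (B i) x y)"
proof -
  have "form N (\<nu> \<cdot>\<^sub>m 1\<^sub>m N + mat_sum N B I) x y
      = (\<Sum>r<N. \<Sum>k<N. (if r = k then \<nu> * (x r * y k) else 0) + (\<Sum>i\<in>I. x r * B i $$ (r, k) * y k))"
    unfolding form_def
    by (intro sum.cong refl) (auto simp: mat_sum_def algebra_simps sum_distrib_left)
  also have "\<dots> = (\<Sum>r<N. \<nu> * (x r * y r)) + (\<Sum>r<N. \<Sum>k<N. \<Sum>i\<in>I. x r * B i $$ (r, k) * y k)"
    by (simp add: sum.distrib)
  also have "(\<Sum>r<N. \<Sum>k<N. \<Sum>i\<in>I. x r * B i $$ (r, k) * y k) = (\<Sum>i\<in>I. form N (B i) x y)"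
    unfolding form_def by (simp only: sum.swap[of _ I])
  finally show ?thesis by (simp add: sum_distrib_left)
qed

lemma form_Atilde:
  "form (total_dim d n) (Atilde d n \<alpha> \<nu> vp vm) x y = \<nu> * (\<Sum>r<total_dim d n. x r * y r)
    + (\<Sum>i\<in>{1..d}. vp i * form (total_dim d n) (Wtilde d n \<alpha> i) x y
        + vm i * form (total_dim d n) (Wtilde d n \<alpha> i) y x)"
proof -
  let ?N = "total_dim d n"
  have "form ?N (vp i \<cdot>\<^sub>m Wtilde d n \<alpha> i + vm i \<cdot>\<^sub>m (Wtilde d n \<alpha> i)\<^sup>T) x y
      = vp i * form ?N (Wtilde d n \<alpha> i) x y + vm i * form ?N (Wtilde d n \<alpha> i) y x"
    if i: "i \<in> {1..d}" for i
  proof -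
    let ?W = "Wtilde d n \<alpha> i"
    have "form ?N (vp i \<cdot>\<^sub>m ?W + vm i \<cdot>\<^sub>m ?W\<^sup>T) x y
        = (\<Sum>r<?N. \<Sum>k<?N. vp i * (x r * ?W $$ (r, k) * y k) + vm i * (y k * ?W $$ (k, r) * x r))"
      unfolding form_def using Wtilde_carrier[OF i, of n \<alpha>]
      by (intro sum.cong refl) (auto simp: algebra_simps)
    also have "\<dots> = vp i * form ?N ?W x y + vm i * (\<Sum>r<?N. \<Sum>k<?N. y k * ?W $$ (k, r) * x r)"
      by (simp add: form_def sum.distrib sum_distrib_left)
    also have "(\<Sum>r<?N. \<Sum>k<?N. y k * ?W $$ (k, r) * x r) = form ?N ?W y x"
      unfolding form_def by (rule sum.swap)
    finally show ?thesis .
  qed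
  thus ?thesis unfolding Atilde_def form_shifted_mat_sum by simp
qed

lemma form_Ptilde:
  "form (total_dim d n) (Ptilde d n \<alpha> \<nu> vp vm) x y = \<nu> * (\<Sum>r<total_dim d n. x r * y r)
    + (\<Sum>i\<in>{1..d}. (vp i + vm i) *
        form (total_dim d n) (lift_dir d n i (tau_mat (sym_part (Ltilde (\<alpha> i) (n i))))) x y)"
proof -
  let ?N = "total_dim d n"
  have "form ?N ((vp i + vm i) \<cdot>\<^sub>m lift_dir d n i (tau_mat (sym_part (Ltilde (\<alpha> i) (n i))))) x y
      = (vp i + vm i) * form ?N (lift_dir d n i (tau_mat (sym_part (Ltilde (\<alpha> i) (n i))))) x y"
    if i: "i \<in> {1..d}" for i
    unfolding form_def sum_distrib_left using lift_dir_carrier[OF i tau_carrier, of n "\<alpha> i"]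
    by (intro sum.cong refl) auto
  thus ?thesis unfolding Ptilde_def form_shifted_mat_sum by simp
qed

lemma Atilde_carrier: "Atilde d n \<alpha> \<nu> vp vm \<in> carrier_mat (total_dim d n) (total_dim d n)"
  by (simp add: Atilde_def mat_sum_def)

lemma Ptilde_carrier: "Ptilde d n \<alpha> \<nu> vp vm \<in> carrier_mat (total_dim d n) (total_dim d n)"
  by (simp add: Ptilde_def mat_sum_def)

lemma persymmetric_Atilde: "persymmetric (total_dim d n) (Atilde d n \<alpha> \<nu> vp vm)"
proof -
  let ?N = "total_dim d n"
  have "Wtilde d n \<alpha> i $$ (?N - Suc r, ?N - Suc c) = Wtilde d n \<alpha> i $$ (c, r)"
    if "i \<in> {1..d}" "r < ?N" "c < ?N" for i r c
    using persymmetric_lift_dir[OF that(1) Ltilde_carrier persymmetric_Ltilde] that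
    by (simp add: Wtilde_def persymmetric_def)
  moreover have "dim_row (Wtilde d n \<alpha> i) = ?N" "dim_col (Wtilde d n \<alpha> i) = ?N" if "i \<in> {1..d}" for i
    using Wtilde_carrier[OF that, of n \<alpha>] by auto
  ultimately show ?thesis
    by (auto simp: persymmetric_def Atilde_def mat_sum_def intro!: sum.cong)
qed

lemma persymmetric_Ptilde: "persymmetric (total_dim d n) (Ptilde d n \<alpha> \<nu> vp vm)"
  and symmetric_Ptilde: "symmetric (total_dim d n) (Ptilde d n \<alpha> \<nu> vp vm)"
proof -
  let ?N = "total_dim d n"
  let ?W = "\<lambda>i. lift_dir d n i (tau_mat (sym_part (Ltilde (\<alpha> i) (n i))))"
  have 1: "?W i $$ (?N - Suc r, ?N - Suc c) = ?W i $$ (c, r)"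
    if "i \<in> {1..d}" "r < ?N" "c < ?N" for i r c
    using persymmetric_lift_dir[OF that(1) tau_carrier persymmetric_tau] that
    by (simp add: persymmetric_def)
  have 2: "?W i $$ (r, c) = ?W i $$ (c, r)" if "i \<in> {1..d}" "r < ?N" "c < ?N" for i r c
    using symmetric_lift_dir[OF that(1) tau_carrier symmetric_tau] that by (simp add: symmetric_def)
  have 3: "dim_row (?W i) = ?N" "dim_col (?W i) = ?N" if "i \<in> {1..d}" for i
    using lift_dir_carrier[OF that tau_carrier, of n "\<alpha> i"] by auto
  show "persymmetric ?N (Ptilde d n \<alpha> \<nu> vp vm)"
    using 1 3 by (auto simp: persymmetric_def Ptilde_def mat_sum_def intro!: sum.cong)
  show "symmetric ?N (Ptilde d n \<alpha> \<nu> vp vm)"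
    using 2 3 by (auto simp: symmetric_def Ptilde_def mat_sum_def intro!: sum.cong)
qed

section \<open>From the preconditioned matrix to a generalized eigenvalue equation\<close>

lemma anti_id_mult_index:
  assumes "A \<in> carrier_mat N N" "r < N" "k < N"
  shows "(anti_id N * A) $$ (r, k) = (A $$ (N - Suc r, k) :: real)"
proof -
  have "(anti_id N * A) $$ (r, k) = (\<Sum>j<N. (if r + j + 1 = N then 1 else 0) * A $$ (j, k))"
    using assms by (simp add: scalar_prod_def anti_id_def atLeast0LessThan)
  also have "\<dots> = (\<Sum>j<N. if j = N - Suc r then A $$ (j, k) else 0)"
    using assms(2) by (intro sum.cong) auto
  also have "\<dots> = A $$ (N - Suc r, k)" using assms(2) by simp
  finally show ?thesis .
qed

text \<open>Multiplying the eigenvector equation by P removes Q, and the flip only reindexes rows.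
  The result has the shape required by \<open>reversed_pencil_eigenvalue\<close>.\<close>

lemma eigenvalue_preconditioned_reversal:
  assumes A: "A \<in> carrier_mat N N" and P: "P \<in> carrier_mat N N" and Q: "Q \<in> carrier_mat N N"
    and PQ: "P * Q = 1\<^sub>m N"
    and ev: "eigenvalue (map_mat complex_of_real (Q * anti_id N * A)) z"
  shows "\<exists>v. (\<exists>r<N. v r \<noteq> 0) \<and>
    (\<forall>r<N. (\<Sum>k<N. of_real (A $$ (N - Suc r, k)) * v k) = z * (\<Sum>k<N. of_real (P $$ (r, k)) * v k))"
proof -
  let ?c = "map_mat complex_of_real"
  let ?M = "Q * anti_id N * A"
  have Y: "anti_id N \<in> carrier_mat N N" by (simp add: anti_id_def)
  have M: "?M \<in> carrier_mat N N" by (rule mult_carrier_mat[OF mult_carrier_mat[OF Q Y] A])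
  obtain v where v: "v \<in> carrier_vec N" "v \<noteq> 0\<^sub>v N" "?c ?M *\<^sub>v v = z \<cdot>\<^sub>v v"
    using ev M unfolding eigenvalue_def eigenvector_def by auto
  have "P * ?M = (P * Q) * (anti_id N * A)"
    unfolding assoc_mult_mat[OF Q Y A]
    by (rule assoc_mult_mat[OF P Q mult_carrier_mat[OF Y A], symmetric])
  hence PM: "P * ?M = anti_id N * A" using PQ left_mult_one_mat[OF mult_carrier_mat[OF Y A]] by simp
  have "?c (anti_id N * A) *\<^sub>v v = ?c P *\<^sub>v (?c ?M *\<^sub>v v)"
    unfolding PM[symmetric] of_real_hom.mat_hom_mult[OF P M]
    using P M v(1) by (intro assoc_mult_mat_vec) auto
  also have "\<dots> = z \<cdot>\<^sub>v (?c P *\<^sub>v v)"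
    unfolding v(3) using P v(1) by (intro mult_mat_vec) auto
  finally have eq: "?c (anti_id N * A) *\<^sub>v v = z \<cdot>\<^sub>v (?c P *\<^sub>v v)" .
  have "(\<Sum>k<N. of_real (A $$ (N - Suc r, k)) * vec_index v k)
      = z * (\<Sum>k<N. of_real (P $$ (r, k)) * vec_index v k)" if r: "r < N" for r
  proof -
    have mult_index: "vec_index (?c C *\<^sub>v v) r = (\<Sum>k<N. of_real (C $$ (r, k)) * vec_index v k)"
      if "C \<in> carrier_mat N N" for C
      using r that v(1) by (simp add: scalar_prod_def atLeast0LessThan)
    have "vec_index (z \<cdot>\<^sub>v (?c P *\<^sub>v v)) r = z * vec_index (?c P *\<^sub>v v) r"
      using r P by simp
    thus ?thesis
      using eq mult_index[OF mult_carrier_mat[OF Y A]] mult_index[OF P]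
      by (simp add: anti_id_mult_index[OF A r])
  qed
  moreover have "\<exists>r<N. vec_index v r \<noteq> 0" using v by (auto simp: vec_eq_iff)
  ultimately show ?thesis by blast
qed

section \<open>Finiteness of the spectrum and bounds for the assembled forms\<close>

lemma finite_eigenvalues:
  fixes A :: "'a :: field mat"
  assumes "A \<in> carrier_mat N N"
  shows "finite {z. eigenvalue A z}"
proof -
  have "char_poly A \<noteq> 0"
    using degree_monic_char_poly[OF assms] by auto
  thus ?thesis
    unfolding eigenvalue_root_char_poly[OF assms] by (rule poly_roots_finite)
qed

lemma sum_squares_pos:
  fixes x :: "nat \<Rightarrow> real"
  assumes "\<exists>r<N. x r \<noteq> 0"
  shows "(\<Sum>r<N. (x r)\<^sup>2) > 0"
proof -
  obtain r where "r < N" "x r \<noteq> 0" using assms by blast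
  thus ?thesis by (intro sum_pos2[of _ r]) auto
qed

text \<open>Sum and difference of the weights \<open>vp i\<close> and \<open>vm i\<close> multiply
  the symmetric and the skew part of the mixed form. The hypothesis on e is free of division, so
  directions with both weights zero need no special case.\<close>

lemma Atilde_form_upper:
  assumes \<alpha>: "\<And>i. i \<in> {1..d} \<Longrightarrow> 1 < \<alpha> i \<and> \<alpha> i < 2"
    and v: "\<And>i. i \<in> {1..d} \<Longrightarrow> 0 \<le> vp i \<and> 0 \<le> vm i"
    and e: "\<And>i. i \<in> {1..d} \<Longrightarrow> \<bar>vp i - vm i\<bar> * \<bar>tan (\<alpha> i / 2 * pi)\<bar> \<le> e * (vp i + vm i)"
    and e0: "e \<ge> 0" and \<nu>: "\<nu> > 0" and x: "\<exists>r<total_dim d n. x r \<noteq> 0"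
  shows "\<bar>form (total_dim d n) (Atilde d n \<alpha> \<nu> vp vm) (reversal (total_dim d n) x) x\<bar>
    < 3/2 * (1 + e) * form (total_dim d n) (Ptilde d n \<alpha> \<nu> vp vm) x x"
proof -
  let ?N = "total_dim d n"
  define y where "y = reversal ?N x"
  define F where "F = (\<lambda>i. form ?N (Wtilde d n \<alpha> i))"
  define G where "G = (\<lambda>i. form ?N (lift_dir d n i (tau_mat (sym_part (Ltilde (\<alpha> i) (n i))))))"
  define E where "E = (\<Sum>r<?N. (x r)\<^sup>2)"
  have dir: "\<bar>vp i * F i y x + vm i * F i x y\<bar> \<le> 3/2 * (1 + e) * ((vp i + vm i) * G i x x)"
    if i: "i \<in> {1..d}" for i
  proof -
    have FG: "G i u u \<le> 2 * F i u u" "2 * F i u u \<le> 3 * G i u u" for u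
      using Wtilde_form_vs_tau[OF i] \<alpha>[OF i] by (simp_all add: F_def G_def)
    \<comment> \<open>This brings the bound at the flipped vector back to x, so that only the form
      of P at x remains.\<close>
    have Gyx: "G i y y = G i x x"
      unfolding G_def y_def
      by (intro form_reversal_reversal persymmetric_lift_dir i tau_carrier persymmetric_tau)
    have F0: "F i u u \<ge> 0" for u using FG[of u] by linarith
    have s: "\<bar>F i y x + F i x y\<bar> \<le> F i x x + F i y y"
      using form_polarization_bound[of ?N "Wtilde d n \<alpha> i" y x] F0 by (simp add: F_def)
    have k: "\<bar>F i y x - F i x y\<bar> \<le> \<bar>tan (\<alpha> i / 2 * pi)\<bar> * (F i x x + F i y y)"
      using Wtilde_sector[OF i, of \<alpha> n y x] \<alpha>[OF i] by (simp add: F_def add.commute)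
    have c: "0 \<le> vp i + vm i" using v[OF i] by simp
    have "\<bar>2 * (vp i * F i y x + vm i * F i x y)\<bar>
        = \<bar>(vp i + vm i) * (F i y x + F i x y) + (vp i - vm i) * (F i y x - F i x y)\<bar>"
      by (rule arg_cong[of _ _ abs]) (simp add: algebra_simps)
    also have "\<dots>
        \<le> (vp i + vm i) * \<bar>F i y x + F i x y\<bar> + \<bar>vp i - vm i\<bar> * \<bar>F i y x - F i x y\<bar>"
      using abs_triangle_ineq[of "(vp i + vm i) * (F i y x + F i x y)" "(vp i - vm i) * (F i y x - F i x y)"] c
      by (simp add: abs_mult)
    also have "\<dots> \<le> (vp i + vm i) * (F i x x + F i y y)
        + \<bar>vp i - vm i\<bar> * (\<bar>tan (\<alpha> i / 2 * pi)\<bar> * (F i x x + F i y y))"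
      using s k c by (intro add_mono mult_left_mono) auto
    also have "\<dots> \<le> (vp i + vm i) * (F i x x + F i y y) + e * (vp i + vm i) * (F i x x + F i y y)"
      using e[OF i] F0[of x] F0[of y] by (auto simp: mult.assoc[symmetric] intro!: mult_right_mono)
    also have "\<dots> = (1 + e) * (vp i + vm i) * (F i x x + F i y y)" by (simp add: algebra_simps)
    also have "\<dots> \<le> (1 + e) * (vp i + vm i) * (3 * G i x x)"
      using FG(2)[of x] FG(2)[of y] Gyx e0 c by (intro mult_left_mono) auto
    also have "\<dots> = 2 * (3/2 * (1 + e) * ((vp i + vm i) * G i x x))" by simp
    finally show ?thesis
      by (simp only: abs_mult abs_numeral mult_le_cancel_left_pos zero_less_numeral)
  qed
  have "(\<Sum>r<?N. (y r)\<^sup>2) = E"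
    unfolding y_def reversal_def E_def by (rule sum.nat_diff_reindex)
  moreover have "\<bar>\<Sum>r<?N. y r * x r\<bar> \<le> (\<Sum>r<?N. ((y r)\<^sup>2 + (x r)\<^sup>2) / 2)"
  proof (rule order_trans[OF sum_abs], rule sum_mono)
    fix r show "\<bar>y r * x r\<bar> \<le> ((y r)\<^sup>2 + (x r)\<^sup>2) / 2"
      using sum_squares_bound[of "\<bar>y r\<bar>" "\<bar>x r\<bar>"] by (simp add: abs_mult)
  qed
  ultimately have yx: "\<bar>\<Sum>r<?N. y r * x r\<bar> \<le> E"
    by (simp add: E_def sum.distrib flip: sum_divide_distrib)
  have E: "E > 0"
    unfolding E_def by (rule sum_squares_pos[OF x])
  have "\<bar>form ?N (Atilde d n \<alpha> \<nu> vp vm) y x\<bar>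
      \<le> \<nu> * \<bar>\<Sum>r<?N. y r * x r\<bar> + \<bar>\<Sum>i\<in>{1..d}. vp i * F i y x + vm i * F i x y\<bar>"
    unfolding form_Atilde F_def using \<nu> by (intro order_trans[OF abs_triangle_ineq]) (simp add: abs_mult)
  also have "\<dots> \<le> \<nu> * E + (\<Sum>i\<in>{1..d}. 3/2 * (1 + e) * ((vp i + vm i) * G i x x))"
    using \<nu> yx by (intro add_mono mult_left_mono order_trans[OF sum_abs sum_mono[OF dir]]) auto
  \<comment> \<open>Strictness comes from here: the identity part needs only the factor 1, which is
    below 3/2 (1 + e).\<close>
  also have "\<dots> < 3/2 * (1 + e) * (\<nu> * E) + (\<Sum>i\<in>{1..d}. 3/2 * (1 + e) * ((vp i + vm i) * G i x x))"
    using \<nu> E e0 mult_strict_right_mono[of 1 "3/2 * (1 + e)" "\<nu> * E"] by simp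
  also have "\<dots> = 3/2 * (1 + e) * form ?N (Ptilde d n \<alpha> \<nu> vp vm) x x"
    unfolding form_Ptilde G_def E_def by (simp add: sum_distrib_left distrib_left power2_eq_square)
  finally show ?thesis by (simp add: y_def)
qed

lemma Ptilde_form_bounds:
  assumes \<alpha>: "\<And>i. i \<in> {1..d} \<Longrightarrow> 1 < \<alpha> i \<and> \<alpha> i < 2"
    and v: "\<And>i. i \<in> {1..d} \<Longrightarrow> 0 \<le> vp i \<and> 0 \<le> vm i"
    and \<nu>: "\<nu> > 0" and x: "\<exists>r<total_dim d n. x r \<noteq> 0"
  shows "0 < form (total_dim d n) (Ptilde d n \<alpha> \<nu> vp vm) x x"
    and "form (total_dim d n) (Ptilde d n \<alpha> \<nu> vp vm) x x
      < 2 * form (total_dim d n) (Atilde d n \<alpha> \<nu> vp vm) x x"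
proof -
  let ?N = "total_dim d n"
  define F where "F = (\<lambda>i. form ?N (Wtilde d n \<alpha> i) x x)"
  define G where "G = (\<lambda>i. form ?N (lift_dir d n i (tau_mat (sym_part (Ltilde (\<alpha> i) (n i))))) x x)"
  define E where "E = \<nu> * (\<Sum>r<?N. x r * x r)"
  have FG: "G i \<le> 2 * F i" "2 * F i \<le> 3 * G i" if "i \<in> {1..d}" for i
    using Wtilde_form_vs_tau[OF that, of \<alpha> n x] \<alpha>[OF that] by (simp_all add: F_def G_def)
  have "(\<Sum>r<?N. x r * x r) > 0"
    using sum_squares_pos[OF x] by (simp add: power2_eq_square)
  hence E: "E > 0" using \<nu> by (simp add: E_def)
  have P: "form ?N (Ptilde d n \<alpha> \<nu> vp vm) x x = E + (\<Sum>i\<in>{1..d}. (vp i + vm i) * G i)"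
    by (simp add: form_Ptilde E_def G_def)
  have A: "form ?N (Atilde d n \<alpha> \<nu> vp vm) x x = E + (\<Sum>i\<in>{1..d}. (vp i + vm i) * F i)"
    by (simp add: form_Atilde E_def F_def distrib_right)
  have "0 \<le> (\<Sum>i\<in>{1..d}. (vp i + vm i) * G i)"
  proof (intro sum_nonneg mult_nonneg_nonneg)
    fix i assume i: "i \<in> {1..d}"
    show "0 \<le> vp i + vm i" using v[OF i] by simp
    show "0 \<le> G i" using FG[OF i] by linarith
  qed
  thus "0 < form ?N (Ptilde d n \<alpha> \<nu> vp vm) x x" unfolding P using E by simp
  have "(\<Sum>i\<in>{1..d}. (vp i + vm i) * G i) \<le> (\<Sum>i\<in>{1..d}. (vp i + vm i) * (2 * F i))"
    using v FG by (intro sum_mono mult_left_mono) (auto simp: add_nonneg_nonneg)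
  also have "\<dots> = 2 * (\<Sum>i\<in>{1..d}. (vp i + vm i) * F i)"
    by (simp add: sum_distrib_left mult.left_commute)
  finally show "form ?N (Ptilde d n \<alpha> \<nu> vp vm) x x < 2 * form ?N (Atilde d n \<alpha> \<nu> vp vm) x x"
    unfolding P A using E by simp
qed

theorem theorem4p3:
  fixes d M :: nat and n :: "nat \<Rightarrow> nat"
    and a b \<alpha> dp dm h vp vm :: "nat \<Rightarrow> real"
    and T \<tau> \<nu> :: real
  assumes d: "d \<ge> 1"
    and ab: "\<And>i. i \<in> {1..d} \<Longrightarrow> a i < b i"
    and alpha: "\<And>i. i \<in> {1..d} \<Longrightarrow> 1 < \<alpha> i \<and> \<alpha> i < 2"
    and dp: "\<And>i. i \<in> {1..d} \<Longrightarrow> 0 \<le> dp i"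
    and dm: "\<And>i. i \<in> {1..d} \<Longrightarrow> 0 \<le> dm i"
    and n: "\<And>i. i \<in> {1..d} \<Longrightarrow> 0 < n i"
    and h: "\<And>i. i \<in> {1..d} \<Longrightarrow> h i = (b i - a i) / (real (n i) + 1)"
    and vp: "\<And>i. i \<in> {1..d} \<Longrightarrow> vp i = dp i / h i powr \<alpha> i"
    and vm: "\<And>i. i \<in> {1..d} \<Longrightarrow> vm i = dm i / h i powr \<alpha> i"
    and T: "T > 0" and M: "M > 0" and tau: "\<tau> = T / real M" and nu: "\<nu> = 1 / \<tau>"
  shows "\<exists>Q \<in> carrier_mat (total_dim d n) (total_dim d n).
           inverts_mat Q (Ptilde d n \<alpha> \<nu> vp vm) \<and> inverts_mat (Ptilde d n \<alpha> \<nu> vp vm) Q \<and>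
           (\<exists>\<epsilon> :: real.
              \<epsilon> < Max ((\<lambda>i. \<bar>dp i - dm i\<bar> / (dp i + dm i) * \<bar>tan (\<alpha> i / 2 * pi)\<bar>) ` {1..d}) \<and>
              (\<forall>z :: complex.
                 eigenvalue (map_mat complex_of_real (Q * Y_mat d n * Atilde d n \<alpha> \<nu> vp vm)) z \<longrightarrow>
                 z \<in> complex_of_real `
                       ({- (3/2 * (1 + \<epsilon>)) <..< - (1/2)} \<union> {1/2 <..< 3/2 * (1 + \<epsilon>)})))"
proof -
  let ?N = "total_dim d n" and ?A = "Atilde d n \<alpha> \<nu> vp vm" and ?P = "Ptilde d n \<alpha> \<nu> vp vm"
  define f where "f = (\<lambda>i. \<bar>dp i - dm i\<bar> / (dp i + dm i) * \<bar>tan (\<alpha> i / 2 * pi)\<bar>)"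
  define e where "e = Max (f ` {1..d})"
  have fe: "f i \<le> e" if "i \<in> {1..d}" for i
    unfolding e_def using that by (intro Max_ge) auto
  have one: "1 \<in> {1..d}" using d by simp
  have "0 \<le> f 1" using dp[OF one] dm[OF one] by (simp add: f_def)
  hence e0: "e \<ge> 0" using fe[OF one] by linarith
  have \<nu>: "\<nu> > 0" using T M by (simp add: nu tau)
  have v: "0 \<le> vp i \<and> 0 \<le> vm i" if "i \<in> {1..d}" for i
    using vp[OF that] vm[OF that] dp[OF that] dm[OF that] by simp
  have skew: "\<bar>vp i - vm i\<bar> * \<bar>tan (\<alpha> i / 2 * pi)\<bar> \<le> e * (vp i + vm i)" if i: "i \<in> {1..d}" for i
  proof -
    \<comment> \<open>The common factor H cancels, so the ratio of difference to sum is the same for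
      the scaled weights as for the diffusion constants.\<close>
    define H where "H = h i powr \<alpha> i"
    have H: "H \<ge> 0" by (simp add: H_def)
    have vi: "vp i = dp i / H" "vm i = dm i / H" using vp[OF i] vm[OF i] by (simp_all add: H_def)
    have "\<bar>dp i - dm i\<bar> * \<bar>tan (\<alpha> i / 2 * pi)\<bar> = f i * (dp i + dm i)"
      \<comment> \<open>If both constants vanish, the quotient in \<open>f\<close> is 0 by the
        convention x / 0 = 0, and the left side is 0 too.\<close>
      using dp[OF i] dm[OF i] by (cases "dp i + dm i = 0") (auto simp: f_def add_nonneg_eq_0_iff)
    also have "\<dots> \<le> e * (dp i + dm i)"
      using fe[OF i] dp[OF i] dm[OF i] by (intro mult_right_mono) auto
    finally have "\<bar>dp i - dm i\<bar> * \<bar>tan (\<alpha> i / 2 * pi)\<bar> / H \<le> e * (dp i + dm i) / H"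
      using H by (rule divide_right_mono)
    moreover have "\<bar>vp i - vm i\<bar> = \<bar>dp i - dm i\<bar> / H"
      using H unfolding vi diff_divide_distrib[symmetric] abs_divide by simp
    ultimately show ?thesis unfolding vi by (simp flip: add_divide_distrib)
  qed
  have pos: "0 < form ?N ?P x x" and lower: "form ?N ?P x x < 2 * form ?N ?A x x"
    and upper: "\<bar>form ?N ?A (reversal ?N x) x\<bar> < 3/2 * (1 + e) * form ?N ?P x x"
    if "\<exists>r<?N. x r \<noteq> 0" for x
    using Ptilde_form_bounds[of d \<alpha> vp vm \<nu> n x] Atilde_form_upper[of d \<alpha> vp vm e \<nu> n x]
      alpha v skew e0 \<nu> that by simp_all
  obtain Q where Q: "Q \<in> carrier_mat ?N ?N" and QP: "Q * ?P = 1\<^sub>m ?N" and PQ: "?P * Q = 1\<^sub>m ?N"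
    using positive_definite_inverse[OF Ptilde_carrier pos] by blast
  define B where "B = map_mat complex_of_real (Q * Y_mat d n * ?A)"
  have B: "B \<in> carrier_mat ?N ?N"
    unfolding B_def Y_mat_eq using Q Atilde_carrier[of d n \<alpha> \<nu> vp vm] by auto
  have loc: "\<exists>s. z = of_real s \<and> 1/2 < \<bar>s\<bar> \<and> \<bar>s\<bar> < 3/2 * (1 + e)" if z: "eigenvalue B z" for z
  proof -
    obtain w where w: "\<exists>r<?N. w r \<noteq> 0" "\<forall>r<?N. (\<Sum>k<?N. of_real (?A $$ (?N - Suc r, k)) * w k)
        = z * (\<Sum>k<?N. of_real (?P $$ (r, k)) * w k)"
      using eigenvalue_preconditioned_reversal[OF Atilde_carrier Ptilde_carrier Q PQ] z
      unfolding B_def Y_mat_eq by blast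
    show ?thesis
      by (rule reversed_pencil_eigenvalue[OF persymmetric_Atilde persymmetric_Ptilde symmetric_Ptilde
            pos lower upper w(1)]) (use w(2) in auto)
  qed
  \<comment> \<open>The 0 keeps the set nonempty. A finite maximum is attained, so the strict bound
    on each eigenvalue passes to \<mu>.\<close>
  define \<mu> where "\<mu> = Max (insert 0 (norm ` {z. eigenvalue B z}))"
  have fin: "finite (insert 0 (norm ` {z. eigenvalue B z}))"
    using finite_eigenvalues[OF B] by simp
  have "\<mu> \<in> insert 0 (norm ` {z. eigenvalue B z})"
    unfolding \<mu>_def by (rule Max_in[OF fin]) simp
  hence \<mu>: "\<mu> < 3/2 * (1 + e)" using loc e0 by fastforce
  \<comment> \<open>Midpoint between e and the solution 2/3 \<mu> - 1 of \<mu> = 3/2 (1 +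
    \<epsilon>), which lies strictly below e. For e = 0 this \<epsilon> is negative.\<close>
  define \<epsilon> where "\<epsilon> = (2/3 * \<mu> - 1 + e) / 2"
  have \<epsilon>: "\<epsilon> < e" "\<mu> < 3/2 * (1 + \<epsilon>)" using \<mu> by (simp_all add: \<epsilon>_def field_simps)
  have "z \<in> complex_of_real ` ({- (3/2 * (1 + \<epsilon>)) <..< - (1/2)} \<union> {1/2 <..< 3/2 * (1 + \<epsilon>)})"
    if z: "eigenvalue B z" for z
  proof -
    obtain s where s: "z = of_real s" "1/2 < \<bar>s\<bar>" using loc[OF z] by blast
    have "norm z \<le> \<mu>" unfolding \<mu>_def using z by (intro Max_ge[OF fin]) auto
    hence "\<bar>s\<bar> < 3/2 * (1 + \<epsilon>)" using \<epsilon> s by simp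
    hence "s \<in> {- (3/2 * (1 + \<epsilon>)) <..< - (1/2)} \<union> {1/2 <..< 3/2 * (1 + \<epsilon>)}"
      using s(2) by (simp only: Un_iff greaterThanLessThan_iff) linarith
    thus ?thesis using s(1) by blast
  qed
  moreover have "inverts_mat Q ?P" "inverts_mat ?P Q"
    using Q QP PQ Ptilde_carrier[of d n \<alpha> \<nu> vp vm] by (auto simp: inverts_mat_def)
  ultimately show ?thesis using Q \<epsilon>(1) unfolding B_def e_def f_def by blast
qed

end
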